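(* Let $a,b\in\mathbb{R}$ with $b\ge 0$, and define polynomials $H_m(z)$ by $$\sum_{m=0}^\infty H_m(z)t^m=\frac{1}{1+t+at^2+zt^2(t-b)}.$$ Then the zeros of $H_m(z)$ are real for all $m$ if and only if $1+a+b\ge 0$ and $9-27a+b\ge 0$. *)

theory Defs
  imports "HOL-Computational_Algebra.Computational_Algebra"
begin

text \<open>The denominator  1 + t + a t^2 + z t^2 (t - b)  as a formal power series in t
  whose coefficients are real polynomials in z:
  coefficients 1, 1, a - b z, z (for t^0, t^1, t^2, t^3).\<close>
definition denomH :: "real \<Rightarrow> real \<Rightarrow> real poly fps" where
  "denomH a b = Abs_fps (\<lambda>n. if n = 0 then 1 else if n = 1 then 1
      else if n = 2 then [:a, - b:] else if n = 3 then [:0, 1:] else 0)"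

definition genH :: "real \<Rightarrow> real \<Rightarrow> real poly fps" where
  "genH a b = (THE G. G * denomH a b = 1)"

definition H :: "real \<Rightarrow> real \<Rightarrow> nat \<Rightarrow> real poly" where
  "H a b m = fps_nth (genH a b) m"

definition real_rooted :: "real poly \<Rightarrow> bool" where
  "real_rooted p \<longleftrightarrow> (\<forall>z::complex. poly (map_poly complex_of_real p) z = 0 \<longrightarrow> z \<in> \<real>)"

end

theory Submission
  imports Defs "HOL-Analysis.Analysis"
begin

text \<open>
  If \<open>s1, s2, s3\<close> are the roots of \<open>s^3 + s^2 + (a - b z) s + z\<close>, then \<open>H m (z)\<close> is the complete
  homogeneous symmetric polynomial of degree \<open>m\<close> in them.

  Under the two inequalities there is, for every angle \<open>\<theta>\<close> in a suitable interval ending at \<open>\<pi>\<close>,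
  exactly one real \<open>z\<close> for which the roots are a pair \<open>r exp (\<plusminus>i \<theta>)\<close> and a real root of modulus less than \<open>r\<close>.
  This \<open>z\<close> depends continuously and injectively on \<open>\<theta>\<close>, and \<open>H m\<close> alternates in sign at the angles
  \<open>k \<pi> / (m + 2)\<close>. That yields all but at most one of the zeros.

  If one of the inequalities fails, then for some real \<open>z0\<close> all three roots are distinct and of the same modulus \<open>r\<close>, two of
  them nonreal. Along a sequence of \<open>m\<close>, the functions \<open>H m (z0 + w / (m + 2)) / r ^ (m + 2)\<close> converge to an
  exponential sum \<open>E w\<close> with three frequencies that are not collinear. A polynomial with only real zeros satisfies
  \<open>norm (p (x + i y)) \<ge> norm (p x)\<close>, and this would be inherited by \<open>E\<close>, but it fails for \<open>E\<close>.
\<close>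

subsection \<open>Recurrence and symmetric function formula\<close>

abbreviation cpoly :: "real poly \<Rightarrow> complex poly" where
  "cpoly \<equiv> map_poly complex_of_real"

lemma cpoly_diff: "cpoly (p - q) = cpoly p - cpoly q"
  by (rule poly_eqI) (simp add: coeff_map_poly)

lemma cpoly_uminus: "cpoly (- p) = - cpoly p"
  by (rule poly_eqI) (simp add: coeff_map_poly)

lemma cpoly_mult: "cpoly (p * q) = cpoly p * cpoly q"
  by (rule poly_eqI) (simp add: coeff_map_poly coeff_mult)

lemma poly_cpoly_of_real: "poly (cpoly p) (of_real x) = of_real (poly p x)"
  by (induction p) (simp_all add: map_poly_pCons)

lemma poly_cpoly_cnj: "poly (cpoly p) (cnj z) = cnj (poly (cpoly p) z)"
  by (rule poly_cnj_real[symmetric]) (simp add: coeff_map_poly)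

text \<open>The constant coefficient of \<open>denomH a b\<close> is 1, so a right inverse exists,
  and by associativity every left inverse equals it. Hence the description in \<open>genH\<close>
  denotes.\<close>

lemma genH_mult: "genH a b * denomH a b = 1"
proof -
  let ?G = "fps_right_inverse (denomH a b) 1"
  have inv: "denomH a b * ?G = 1"
    by (rule fps_right_inverse) (simp add: denomH_def)
  have "G = ?G" if "G * denomH a b = 1" for G
  proof -
    have "G = G * (denomH a b * ?G)" unfolding inv by (rule mult_1_right[symmetric])
    also have "\<dots> = G * denomH a b * ?G" by (rule mult.assoc[symmetric])
    finally show ?thesis unfolding that mult_1_left .
  qed
  moreover have "?G * denomH a b = 1"
    using inv unfolding mult.commute[of _ "denomH a b"] .
  ultimately show ?thesis
    unfolding genH_def by (rule theI[rotated])
qed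

lemma denomH_altdef:
  "denomH a b = 1 + fps_X + fps_const [:a, - b:] * fps_X ^ 2 + fps_const [:0, 1:] * fps_X ^ 3"
  by (rule fps_ext) (auto simp: denomH_def fps_X_power_iff)

lemma H_coeff:
  "H a b n + (if n < 1 then 0 else H a b (n - 1)) + (if n < 2 then 0 else [:a, - b:] * H a b (n - 2))
     + (if n < 3 then 0 else [:0, 1:] * H a b (n - 3)) = (if n = 0 then 1 else 0)"
proof -
  have "genH a b * denomH a b = genH a b + genH a b * fps_X ^ 1
      + fps_const [:a, - b:] * (genH a b * fps_X ^ 2) + fps_const [:0, 1:] * (genH a b * fps_X ^ 3)"
    unfolding denomH_altdef by (simp add: algebra_simps)
  then have "fps_nth (genH a b + genH a b * fps_X ^ 1
      + fps_const [:a, - b:] * (genH a b * fps_X ^ 2) + fps_const [:0, 1:] * (genH a b * fps_X ^ 3)) n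
      = fps_nth 1 n"
    by (simp add: genH_mult)
  then show ?thesis
    unfolding fps_add_nth fps_mult_left_const_nth fps_X_power_mult_right_nth H_def fps_one_nth
    by (auto split: if_splits)
qed

lemma H_0: "H a b 0 = 1"
  using H_coeff[of a b 0] by simp

lemma H_1: "H a b 1 = - 1"
  using H_coeff[of a b 1] by (simp add: H_0 eq_neg_iff_add_eq_0 add.commute)

lemma H_2: "H a b 2 = [:1 - a, b:]"
proof -
  have "H a b 2 + H a b 1 + [:a, - b:] * H a b 0 = 0"
    using H_coeff[of a b 2] by simp
  then have "H a b 2 = 1 - [:a, - b:]"
    unfolding H_0 H_1 by (simp add: algebra_simps eq_diff_eq add_eq_0_iff)
  then show ?thesis by (simp add: one_pCons)
qed

lemma H_rec: "H a b (Suc (Suc (Suc m))) =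
  - H a b (Suc (Suc m)) - [:a, - b:] * H a b (Suc m) - [:0, 1:] * H a b m"
proof -
  have "H a b (m + 3) + H a b (m + 2) + [:a, - b:] * H a b (m + 1) + [:0, 1:] * H a b m = 0"
    using H_coeff[of a b "m + 3"] by simp
  then show ?thesis
    by (simp add: numeral_eq_Suc algebra_simps eq_neg_iff_add_eq_0)
qed

section \<open>Degree bounds\<close>

lemma nat_induct3 [case_names 0 1 2 step]:
  assumes "P 0" "P (Suc 0)" "P (Suc (Suc 0))"
    and "\<And>n. P n \<Longrightarrow> P (Suc n) \<Longrightarrow> P (Suc (Suc n)) \<Longrightarrow> P (Suc (Suc (Suc n)))"
  shows "P (n::nat)"
proof -
  have "P n \<and> P (Suc n) \<and> P (Suc (Suc n))"
    by (induction n) (use assms in auto)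
  then show ?thesis ..
qed

lemma degree_H_le: "degree (H a b m) \<le> m div 2"
proof (induction m rule: nat_induct3)
  case (step m)
  have 1: "degree (H a b (Suc (Suc m))) \<le> Suc (m div 2)"
    using step by simp
  have "degree ([:a, - b:] * H a b (Suc m)) \<le> Suc (Suc m div 2)"
    using degree_mult_le[of "[:a, - b:]" "H a b (Suc m)"] step by (simp split: if_splits)
  then have 2: "degree ([:a, - b:] * H a b (Suc m)) \<le> Suc (Suc (Suc m)) div 2"
    by simp
  have 3: "degree ([:0, 1:] * H a b m) \<le> Suc (m div 2)"
    using degree_mult_le[of "[:0, 1:]" "H a b m"] step by simp
  show ?case
    unfolding H_rec using 1 2 3 by (intro degree_diff_le) (auto simp: le_diff_conv)
next
  case 1
  show ?case using H_1[of a b] by simp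
next
  case 2
  show ?case using H_2[of a b] by (simp add: numeral_2_eq_2)
qed (simp add: H_0)

text \<open>For \<open>b = 0\<close> the middle coefficient of the recurrence is constant in z, so
  the degree can rise only through the last term, once in three steps. The sharper bound matches the
  shorter angle interval of that case.\<close>

lemma degree_H_le_0: "degree (H a 0 m) \<le> m div 3"
proof (induction m rule: nat_induct3)
  case (step m)
  have "degree ([:a, - 0:] * H a 0 (Suc m)) \<le> degree (H a 0 (Suc m))"
    by (simp add: degree_smult_le)
  then have 2: "degree ([:a, - 0:] * H a 0 (Suc m)) \<le> Suc m div 3"
    using step(2) by linarith
  have 3: "degree ([:0, 1:] * H a 0 m) \<le> Suc (m div 3)"
    using degree_mult_le[of "[:0, 1:]" "H a 0 m"] step by simp
  show ?case
    unfolding H_rec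
  proof (intro degree_diff_le)
    show "degree (- H a 0 (Suc (Suc m))) \<le> Suc (Suc (Suc m)) div 3"
      using step(3) unfolding degree_minus by linarith
    show "degree ([:a, - 0:] * H a 0 (Suc m)) \<le> Suc (Suc (Suc m)) div 3"
      using 2 by linarith
    show "degree ([:0, 1:] * H a 0 m) \<le> Suc (Suc (Suc m)) div 3"
      using 3 by linarith
  qed
next
  case 1
  show ?case using H_1[of a 0] by simp
next
  case 2
  show ?case using H_2[of a 0] by (simp add: numeral_2_eq_2)
qed (simp add: H_0)

section \<open>\<open>H\<close> in terms of the roots of its characteristic cubic\<close>

lemma poly_H_rec:
  "poly (cpoly (H a b (Suc (Suc (Suc m))))) z = - poly (cpoly (H a b (Suc (Suc m)))) z
     - (a - b * z) * poly (cpoly (H a b (Suc m))) z - z * poly (cpoly (H a b m)) z"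
proof -
  have "cpoly [:a, - b:] = [:of_real a, - of_real b:]" "cpoly [:0, 1:] = [:0, 1:]"
    by (simp_all add: map_poly_pCons)
  then show ?thesis
    unfolding H_rec cpoly_diff cpoly_uminus cpoly_mult poly_diff poly_minus poly_mult by simp
qed

text \<open>The powers of each root satisfy the recurrence of \<open>H\<close>, so both sides do,
  and three initial values remain to be compared. Multiplying by the Vandermonde product instead of
  dividing keeps the identity valid for repeated roots.\<close>

lemma poly_H_roots:
  fixes s1 s2 s3 z :: complex and a b :: real
  assumes e1: "s1 + s2 + s3 = -1" and e2: "s1 * s2 + s1 * s3 + s2 * s3 = a - b * z"
    and e3: "s1 * s2 * s3 = - z"
  shows "poly (cpoly (H a b m)) z * ((s1 - s2) * (s1 - s3) * (s2 - s3)) =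
    s1 ^ (m + 2) * (s2 - s3) - s2 ^ (m + 2) * (s1 - s3) + s3 ^ (m + 2) * (s1 - s2)"
proof -
  have z: "z = - (s1 * s2 * s3)" using e3 by simp
  have A: "a - b * z = s1 * s2 + s1 * s3 + s2 * s3" using e2 by simp
  have s3: "s3 = - 1 - s1 - s2" using e1 by (simp add: algebra_simps)
  show ?thesis
  proof (induction m rule: nat_induct3)
    case 0
    show ?case by (simp add: H_0 power2_eq_square algebra_simps)
  next
    case 1
    show ?case using H_1[of a b]
      by (simp add: s3 power3_eq_cube[simplified numeral_3_eq_3] cpoly_uminus algebra_simps)
  next
    case 2
    have "poly (cpoly (H a b (Suc (Suc 0)))) z = 1 - (a - b * z)"
      using H_2[of a b] by (simp add: numeral_2_eq_2 map_poly_pCons)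
    then show ?case unfolding A unfolding s3
      by (simp add: numeral_2_eq_2 algebra_simps)
  next
    case (step m)
    let ?V = "(s1 - s2) * (s1 - s3) * (s2 - s3)"
    let ?h = "\<lambda>m. poly (cpoly (H a b m)) z"
    have root: "s ^ (n + 3) = - (s ^ (n + 2)) - (a - b * z) * s ^ (n + 1) - z * s ^ n"
      if "s \<in> {s1, s2, s3}" for s n
    proof -
      have "(s - s1) * (s - s2) * (s - s3) = 0" using that by auto
      moreover have "(s - s1) * (s - s2) * (s - s3) = s ^ 3 - (s1 + s2 + s3) * s ^ 2
          + (s1 * s2 + s1 * s3 + s2 * s3) * s - s1 * s2 * s3"
        by (simp add: algebra_simps power3_eq_cube power2_eq_square)
      ultimately have "s ^ 3 = - (s ^ 2) - (a - b * z) * s - z"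
        unfolding assms by (simp add: algebra_simps eq_neg_iff_add_eq_0 add_eq_0_iff)
      then have "s ^ n * s ^ 3 = s ^ n * (- (s ^ 2) - (a - b * z) * s - z)" by simp
      then show ?thesis by (simp add: power_add power2_eq_square algebra_simps)
    qed
    have "?h (Suc (Suc (Suc m))) * ?V = - (?h (Suc (Suc m)) * ?V)
       - (a - b * z) * (?h (Suc m) * ?V) - z * (?h m * ?V)"
      unfolding poly_H_rec by (simp add: algebra_simps)
    also have "\<dots> = (- (s1 ^ (m + 2 + 2)) - (a - b * z) * s1 ^ (m + 2 + 1) - z * s1 ^ (m + 2)) * (s2 - s3)
        - (- (s2 ^ (m + 2 + 2)) - (a - b * z) * s2 ^ (m + 2 + 1) - z * s2 ^ (m + 2)) * (s1 - s3)
        + (- (s3 ^ (m + 2 + 2)) - (a - b * z) * s3 ^ (m + 2 + 1) - z * s3 ^ (m + 2)) * (s1 - s2)"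
      unfolding step by (simp only: add_Suc add_Suc_right add_2_eq_Suc' add_2_eq_Suc One_nat_def add_0_right)
        (simp only: ring_distribs mult_minus_left mult_minus_right diff_conv_add_uminus minus_add_distrib minus_minus ac_simps)
    also have "\<dots> = s1 ^ (m + 2 + 3) * (s2 - s3) - s2 ^ (m + 2 + 3) * (s1 - s3) + s3 ^ (m + 2 + 3) * (s1 - s2)"
      using root[of s1 "m + 2"] root[of s2 "m + 2"] root[of s3 "m + 2"] by simp
    finally show ?case by (simp add: add.commute numeral_eq_Suc)
  qed
qed

text \<open>Every zero t is real, so in the factorization no factor \<open>z - t\<close> gets
  smaller in modulus when z leaves the real axis vertically.\<close>

lemma norm_poly_real_rooted_ge:
  assumes "real_rooted p"
  shows "norm (poly (cpoly p) (of_real x)) \<le> norm (poly (cpoly p) (Complex x y))"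
proof (cases "cpoly p = 0")
  case False
  obtain A where A: "cpoly p = smult (lead_coeff (cpoly p)) (\<Prod>r\<in>#A. [:-r, 1:])"
    using alg_closed_imp_factorization[OF False] by blast
  have ev: "poly (cpoly p) w = lead_coeff (cpoly p) * (\<Prod>r\<in>#A. w - r)" for w
    by (subst A) (simp add: poly_prod_mset image_mset.compositionality o_def)
  have re: "r \<in> \<real>" if "r \<in># A" for r
  proof -
    have "poly (cpoly p) r = 0"
      unfolding ev using that by (auto simp: prod_mset_zero_iff)
    then show ?thesis using assms unfolding real_rooted_def by auto
  qed
  have *: "norm (\<Prod>r\<in>#B. complex_of_real x - r) \<le> norm (\<Prod>r\<in>#B. Complex x y - r)"
    if "\<And>r. r \<in># B \<Longrightarrow> r \<in> \<real>" for B
    using that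
  proof (induction B)
    case (add r B)
    obtain t where t: "r = of_real t" using add.prems by (auto elim: Reals_cases)
    have "norm (complex_of_real x - r) \<le> norm (Complex x y - r)"
      unfolding t using abs_Re_le_cmod[of "Complex x y - of_real t"]
      by (simp flip: of_real_diff)
    then show ?case
      using add by (auto simp: norm_mult intro!: mult_mono)
  qed auto
  show ?thesis
    unfolding ev norm_mult using *[of A] re by (intro mult_left_mono) auto
qed auto

text \<open>A nonreal zero brings its conjugate along; with \<open>R\<close> this makes
  \<open>card R + 2\<close> distinct zeros, more than the degree allows.\<close>

lemma real_rootedI_card:
  assumes "p \<noteq> 0" "finite R" "\<And>x. x \<in> R \<Longrightarrow> poly p x = 0" "degree p \<le> card R + 1"
  shows "real_rooted p"
  unfolding real_rooted_def
proof (intro allI impI, rule ccontr)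
  fix z :: complex
  assume z: "poly (cpoly p) z = 0" and nr: "z \<notin> \<real>"
  have p0: "cpoly p \<noteq> 0" using assms(1) by (simp add: map_poly_eq_0_iff)
  have "insert z (insert (cnj z) (of_real ` R)) \<subseteq> {x. poly (cpoly p) x = 0}"
    using z assms(3) by (auto simp: poly_cpoly_cnj poly_cpoly_of_real)
  then have "card (insert z (insert (cnj z) (of_real ` R))) \<le> card {x. poly (cpoly p) x = 0}"
    by (intro card_mono poly_roots_finite p0)
  also have "\<dots> \<le> degree (cpoly p)" by (rule card_poly_roots_bound[OF p0])
  also have "\<dots> = degree p" by (rule degree_map_poly) simp
  also have "card (insert z (insert (cnj z) (of_real ` R))) = card R + 2"
  proof -
    have "cnj z \<notin> of_real ` R" "z \<notin> of_real ` R" "z \<noteq> cnj z"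
      using nr by (auto simp: Reals_cnj_iff dest: arg_cong[of _ _ cnj])
    then show ?thesis
      using assms(2) by (simp add: card_image inj_on_def)
  qed
  finally show False using assms(4) by simp
qed

subsection \<open>Sufficiency\<close>

text \<open>
  If \<open>s = exp (\<plusminus>i \<theta>) / u\<close> with \<open>x = - cos \<theta>\<close> are two roots of \<open>s^3 + s^2 + (a - b z) s + z\<close>, then the third one is
  \<open>(2 x - u) / u\<close> and \<open>z = (u - 2 x) / u^3\<close>. What remains of Vieta's relations is that
  \<open>u\<close> is a root of the following cubic.
\<close>
definition gcub :: "real \<Rightarrow> real \<Rightarrow> real \<Rightarrow> real \<Rightarrow> real" where
  "gcub a b x u = - a * u ^ 3 + 2 * x * u ^ 2 + (1 + b - 4 * x ^ 2) * u - 2 * b * x"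

text \<open>For \<open>a \<le> 0\<close> the quotient \<open>gcub a b x u / u\<close> is strictly
  increasing in \<open>u > 0\<close>, because each of its terms is nondecreasing and
  \<open>2 * x * u\<close> increases strictly. The inequality is stated without
  denominators.\<close>

lemma gcub_secant_mono:
  assumes "a \<le> 0" "b \<ge> 0" "0 < x" "0 < p" "p < q"
  shows "q * gcub a b x p < p * gcub a b x q"
proof -
  have "p * gcub a b x q - q * gcub a b x p = (q - p) * (- a * (p * q * (p + q)) + 2 * x * (p * q) + 2 * b * x)"
    by (simp add: gcub_def power2_eq_square power3_eq_cube algebra_simps)
  moreover have "- a * (p * q * (p + q)) \<ge> 0" "2 * x * (p * q) > 0" "2 * b * x \<ge> 0"
    using assms by (auto intro!: mult_nonneg_nonneg mult_pos_pos simp: mult_nonpos_nonneg)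
  ultimately show ?thesis
    using assms mult_pos_pos[of "q - p" "- a * (p * q * (p + q)) + 2 * x * (p * q) + 2 * b * x"] by linarith
qed

text \<open>For \<open>a \<ge> 0\<close> the quotient \<open>gcub a b x u / u\<close> is concave in
  \<open>u > 0\<close>, its nonlinear terms being \<open>- a * u ^ 2\<close> and
  \<open>- 2 * b * x / u\<close>. This is the three-point inequality multiplied by
  \<open>p * q * R\<close>.\<close>

lemma gcub_secant_concave:
  assumes "a \<ge> 0" "b \<ge> 0" "0 < x" "0 < p" "p < q" "q < R"
  shows "q * R * (R - q) * gcub a b x p + p * q * (q - p) * gcub a b x R \<le> p * R * (R - p) * gcub a b x q"
proof -
  have "q * R * (R - q) * gcub a b x p + p * q * (q - p) * gcub a b x R - p * R * (R - p) * gcub a b x q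
     = - ((R - q) * (q - p) * (R - p) * (a * (p * q * R) + 2 * b * x))"
    by (simp add: gcub_def power2_eq_square power3_eq_cube algebra_simps)
  moreover have "(R - q) * (q - p) * (R - p) * (a * (p * q * R) + 2 * b * x) \<ge> 0"
    using assms by (intro mult_nonneg_nonneg add_nonneg_nonneg) auto
  ultimately show ?thesis by linarith
qed

lemma cubic_roots_unique:
  fixes s s' t t' :: complex and \<sigma> \<sigma>' :: complex
  assumes "s + t + \<sigma> = s' + t' + \<sigma>'"
    "s * t + s * \<sigma> + t * \<sigma> = s' * t' + s' * \<sigma>' + t' * \<sigma>'"
    "s * t * \<sigma> = s' * t' * \<sigma>'"
  shows "s = s' \<or> s = t' \<or> s = \<sigma>'"
proof -
  have "(s - s') * (s - t') * (s - \<sigma>') = s ^ 3 - (s' + t' + \<sigma>') * s ^ 2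
      + (s' * t' + s' * \<sigma>' + t' * \<sigma>') * s - s' * t' * \<sigma>'"
    by (simp add: algebra_simps power3_eq_cube power2_eq_square)
  also have "\<dots> = 0"
    unfolding assms[symmetric] by (simp add: algebra_simps power3_eq_cube power2_eq_square)
  finally show ?thesis by simp
qed

section \<open>The modulus of the conjugate pair as a function of x\<close>

locale admissible =
  fixes a b :: real
  assumes b: "b \<ge> 0" and lower: "1 + a + b \<ge> 0" and upper: "9 - 27 * a + b \<ge> 0"
begin

text \<open>In terms of \<open>x = - cos \<theta>\<close>, the angle starts at \<pi>/2 in general
  and at 2\<pi>/3 for \<open>b = 0\<close>. When \<open>b > 0\<close> the cubic is negative at
  \<open>u = 0\<close> for all \<open>x > 0\<close>; when \<open>b = 0\<close> it vanishes there,
  and the left end \<open>2 * x - 1\<close> has to be positive.\<close>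

definition x_min :: real where "x_min = (if b = 0 then 1 / 2 else 0)"

lemma x_min_nonneg: "x_min \<ge> 0"
  by (simp add: x_min_def)

text \<open>
  The bounds \<open>2 x - 1 < u < 2 x + 1\<close> express that the third root is dominated by the conjugate pair.
  The two hypotheses on \<open>a\<close> and \<open>b\<close> are the sign conditions at the two ends for \<open>x = 1\<close>.
\<close>
lemma gcub_left:
  assumes "x_min < x" "x < 1"
  shows "gcub a b x (max 0 (2 * x - 1)) < 0"
proof (cases "2 * x - 1 > 0")
  case True
  define w where "w = 2 * x - 1"
  have w: "0 < w" "w < 1" "x = (w + 1) / 2" using True assms by (auto simp: w_def)
  \<comment> \<open>At this end the third root is \<open>1 / w\<close>, as large as the conjugate
    pair, and the cubic collapses to a form to which \<open>lower\<close> applies.\<close>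
  have "gcub a b x w = - (w ^ 2 + b + a * w ^ 3)"
    unfolding w(3) by (simp add: gcub_def field_simps power2_eq_square power3_eq_cube)
  moreover have "- (1 + b) * w ^ 3 \<le> a * w ^ 3"
    using w lower by (intro mult_right_mono) auto
  moreover have "w ^ 3 < w ^ 2" using w by (intro power_strict_decreasing) auto
  moreover have "b * w ^ 3 \<le> b * 1" using w b by (intro mult_left_mono power_le_one) auto
  ultimately have "gcub a b x w < 0" by (simp add: algebra_simps)
  then show ?thesis using True by (simp add: w_def max_def)
next
  case False
  then have "b > 0" "x > 0" using assms b by (auto simp: x_min_def split: if_splits)
  with False show ?thesis by (simp add: gcub_def max_def)
qed

lemma gcub_right:
  assumes "x_min < x" "x < 1"
  shows "gcub a b x (2 * x + 1) > 0"
proof -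
  define v where "v = 2 * x + 1"
  have v: "0 < v" "v < 3" "x = (v - 1) / 2" using assms x_min_nonneg by (auto simp: v_def)
  have "gcub a b x v = v ^ 2 + b - a * v ^ 3"
    unfolding v(3) by (simp add: gcub_def field_simps power2_eq_square power3_eq_cube)
  moreover have "a * v ^ 3 \<le> (9 + b) / 27 * v ^ 3"
    using v upper by (intro mult_right_mono) auto
  moreover have "v ^ 3 < 3 * v ^ 2" using v by (simp add: power2_eq_square power3_eq_cube)
  moreover have "b * v ^ 3 \<le> b * 3 ^ 3"
    using v b by (intro mult_left_mono power_mono) auto
  ultimately have "gcub a b x v > 0" by (simp add: algebra_simps)
  then show ?thesis by (simp add: v_def)
qed

text \<open>The intermediate value theorem gives a zero. The sign on either side follows from
  \<open>gcub a b x u / u\<close>: by monotonicity for \<open>a \<le> 0\<close>, otherwise by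
  concavity together with the positive value at the right end.\<close>

lemma gcub_sign:
  assumes "x_min < x" "x < 1"
  obtains u where "max 0 (2 * x - 1) < u" "u < 2 * x + 1" "gcub a b x u = 0"
    "\<And>v. max 0 (2 * x - 1) < v \<Longrightarrow> v < u \<Longrightarrow> gcub a b x v < 0"
    "\<And>v. u < v \<Longrightarrow> v < 2 * x + 1 \<Longrightarrow> gcub a b x v > 0"
proof -
  let ?L = "max 0 (2 * x - 1)" and ?R = "2 * x + 1"
  have x: "x > 0" using assms x_min_nonneg by simp
  have L: "gcub a b x ?L < 0" and R: "gcub a b x ?R > 0"
    using gcub_left gcub_right assms by auto
  have "\<exists>u\<ge>?L. u \<le> ?R \<and> gcub a b x u = 0"
    using L R x assms by (intro IVT') (auto simp: gcub_def intro!: continuous_intros)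
  then obtain u where u: "?L \<le> u" "u \<le> ?R" "gcub a b x u = 0" by blast
  have uL: "?L < u" using u L by (metis order_less_irrefl order_less_le)
  have uR: "u < ?R" using u R by (metis order_less_irrefl order_less_le)
  have u0: "u > 0" using uL by simp
  show ?thesis
  proof (rule that[OF uL uR u(3)])
    fix v assume v: "?L < v" "v < u"
    then have v0: "v > 0" by simp
    show "gcub a b x v < 0"
    proof (cases "a \<le> 0")
      case True
      have "u * gcub a b x v < 0"
        using gcub_secant_mono[OF True b x v0 v(2)] u by simp
      then show ?thesis using u0 by (simp add: mult_less_0_iff)
    next
      case False
      have "u * ?R * (?R - u) * gcub a b x v + v * u * (u - v) * gcub a b x ?R \<le> 0"
        using gcub_secant_concave[of a b x v u ?R] False b x v0 v uR u by simp
      moreover have "v * u * (u - v) * gcub a b x ?R > 0"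
        using v0 u0 v R by (intro mult_pos_pos) auto
      ultimately have "u * ?R * (?R - u) * gcub a b x v < 0" by linarith
      moreover have "u * ?R * (?R - u) > 0" using u0 x uR by (intro mult_pos_pos) auto
      ultimately show ?thesis using mult_less_0_iff by (metis order_less_asym)
    qed
  next
    fix v assume v: "u < v" "v < ?R"
    show "gcub a b x v > 0"
    proof (cases "a \<le> 0")
      case True
      have "u * gcub a b x v > 0"
        using gcub_secant_mono[OF True b x u0 v(1)] u by simp
      then show ?thesis using u0 by (simp add: zero_less_mult_iff)
    next
      case False
      have "u * v * (v - u) * gcub a b x ?R \<le> u * ?R * (?R - u) * gcub a b x v"
        using gcub_secant_concave[of a b x u v ?R] False b x u0 v u by simp
      moreover have "u * v * (v - u) * gcub a b x ?R > 0"
        using u0 v R by (intro mult_pos_pos) auto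
      ultimately have "u * ?R * (?R - u) * gcub a b x v > 0" by linarith
      moreover have "u * ?R * (?R - u) > 0" using u0 x uR by (intro mult_pos_pos) auto
      ultimately show ?thesis using zero_less_mult_pos by blast
    qed
  qed
qed

definition inv_modulus :: "real \<Rightarrow> real" where
  "inv_modulus x = (SOME u. max 0 (2 * x - 1) < u \<and> u < 2 * x + 1 \<and> gcub a b x u = 0)"

lemma inv_modulus:
  assumes "x_min < x" "x < 1"
  shows "0 < inv_modulus x" "2 * x - 1 < inv_modulus x" "inv_modulus x < 2 * x + 1" "gcub a b x (inv_modulus x) = 0"
    and inv_modulus_less_iff: "\<And>v. max 0 (2 * x - 1) < v \<Longrightarrow> v < 2 * x + 1 \<Longrightarrow> gcub a b x v < 0 \<longleftrightarrow> v < inv_modulus x"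
    and inv_modulus_gt_iff: "\<And>v. max 0 (2 * x - 1) < v \<Longrightarrow> v < 2 * x + 1 \<Longrightarrow> gcub a b x v > 0 \<longleftrightarrow> v > inv_modulus x"
proof -
  obtain u where u: "max 0 (2 * x - 1) < u" "u < 2 * x + 1" "gcub a b x u = 0"
    "\<And>v. max 0 (2 * x - 1) < v \<Longrightarrow> v < u \<Longrightarrow> gcub a b x v < 0"
    "\<And>v. u < v \<Longrightarrow> v < 2 * x + 1 \<Longrightarrow> gcub a b x v > 0"
    using gcub_sign[OF assms] by blast
  have "inv_modulus x = u"
    unfolding inv_modulus_def
  proof (rule some_equality)
    fix v assume v: "max 0 (2 * x - 1) < v \<and> v < 2 * x + 1 \<and> gcub a b x v = 0"
    then show "v = u" using u(4)[of v] u(5)[of v] by (cases v u rule: linorder_cases) auto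
  qed (use u in auto)
  then show "0 < inv_modulus x" "2 * x - 1 < inv_modulus x" "inv_modulus x < 2 * x + 1" "gcub a b x (inv_modulus x) = 0"
    using u(1-3) by auto
  fix v assume v: "max 0 (2 * x - 1) < v" "v < 2 * x + 1"
  show "gcub a b x v < 0 \<longleftrightarrow> v < inv_modulus x" "gcub a b x v > 0 \<longleftrightarrow> v > inv_modulus x"
    using u(3) u(4)[of v] u(5)[of v] v unfolding \<open>inv_modulus x = u\<close>
    by (cases v u rule: linorder_cases; simp)+
qed

text \<open>For fixed v the sign of \<open>gcub a b y v\<close> tells on which side of
  \<open>inv_modulus y\<close> the point v lies. A strict sign persists for y near x, so v stays on
  its side.\<close>

lemma continuous_inv_modulus: "continuous_on {x_min<..<1} inv_modulus"
proof -
  have "isCont inv_modulus x" if x: "x_min < x" "x < 1" for x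
    unfolding isCont_def
  proof (rule order_tendstoI)
    have ev: "\<forall>\<^sub>F y in at x. y \<in> {x_min<..<1}"
      using x by (intro eventually_at_in_open') auto
    have cont: "((\<lambda>y. gcub a b y v) \<longlongrightarrow> gcub a b x v) (at x)"
      "((\<lambda>y. max 0 (2 * y - 1)) \<longlongrightarrow> max 0 (2 * x - 1)) (at x)"
      "((\<lambda>y. 2 * y + 1) \<longlongrightarrow> 2 * x + 1) (at x)" for v
      unfolding gcub_def by (intro tendsto_intros)+
    fix l assume "l < inv_modulus x"
    then have "max l (max 0 (2 * x - 1)) < inv_modulus x" using inv_modulus[OF x] by simp
    then obtain v where v: "max l (max 0 (2 * x - 1)) < v" "v < inv_modulus x" using dense by blast
    then have "gcub a b x v < 0" using inv_modulus_less_iff[OF x, of v] inv_modulus[OF x] by auto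
    then have "\<forall>\<^sub>F y in at x. gcub a b y v < 0" by (rule order_tendstoD[OF cont(1)])
    moreover have "\<forall>\<^sub>F y in at x. max 0 (2 * y - 1) < v"
      using v by (intro order_tendstoD[OF cont(2)]) auto
    moreover have "\<forall>\<^sub>F y in at x. v < 2 * y + 1"
      using v inv_modulus[OF x] by (intro order_tendstoD[OF cont(3)]) auto
    ultimately show "\<forall>\<^sub>F y in at x. l < inv_modulus y"
      using ev
    proof eventually_elim
      case (elim y)
      then have "v < inv_modulus y" using inv_modulus_less_iff[of y v] by auto
      then show ?case using v by auto
    qed
  next
    have ev: "\<forall>\<^sub>F y in at x. y \<in> {x_min<..<1}"
      using x by (intro eventually_at_in_open') auto
    have cont: "((\<lambda>y. gcub a b y v) \<longlongrightarrow> gcub a b x v) (at x)"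
      "((\<lambda>y. max 0 (2 * y - 1)) \<longlongrightarrow> max 0 (2 * x - 1)) (at x)"
      "((\<lambda>y. 2 * y + 1) \<longlongrightarrow> 2 * x + 1) (at x)" for v
      unfolding gcub_def by (intro tendsto_intros)+
    fix l assume "inv_modulus x < l"
    then have "inv_modulus x < min l (2 * x + 1)" using inv_modulus[OF x] by simp
    then obtain v where v: "v < min l (2 * x + 1)" "inv_modulus x < v" using dense by blast
    then have "gcub a b x v > 0" using inv_modulus_gt_iff[OF x, of v] inv_modulus[OF x] by auto
    then have "\<forall>\<^sub>F y in at x. gcub a b y v > 0" by (rule order_tendstoD[OF cont(1)])
    moreover have "\<forall>\<^sub>F y in at x. max 0 (2 * y - 1) < v"
      using v inv_modulus[OF x] by (intro order_tendstoD[OF cont(2)]) auto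
    moreover have "\<forall>\<^sub>F y in at x. v < 2 * y + 1"
      using v by (intro order_tendstoD[OF cont(3)]) auto
    ultimately show "\<forall>\<^sub>F y in at x. inv_modulus y < l"
      using ev
    proof eventually_elim
      case (elim y)
      then have "v > inv_modulus y" using inv_modulus_gt_iff[of y v] by auto
      then show ?case using v by auto
    qed
  qed
  then show ?thesis by (intro continuous_at_imp_continuous_on) auto
qed

section \<open>The parameter z and its three roots along the curve\<close>

definition z_at :: "real \<Rightarrow> real" where
  "z_at x = (inv_modulus x - 2 * x) / inv_modulus x ^ 3"

lemma continuous_z_at: "continuous_on {x_min<..<1} z_at"
  unfolding z_at_def using inv_modulus(1) by (intro continuous_intros continuous_inv_modulus) force

definition s_pair :: "real \<Rightarrow> complex" where
  "s_pair x = Complex (- x) (sqrt (1 - x ^ 2)) / of_real (inv_modulus x)"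

definition s_third :: "real \<Rightarrow> complex" where
  "s_third x = of_real ((2 * x - inv_modulus x) / inv_modulus x)"

lemma vieta:
  assumes "x_min < x" "x < 1"
  shows "s_pair x + cnj (s_pair x) + s_third x = - 1"
    "s_pair x * cnj (s_pair x) + s_pair x * s_third x + cnj (s_pair x) * s_third x = of_real a - of_real b * of_real (z_at x)"
    "s_pair x * cnj (s_pair x) * s_third x = - of_real (z_at x)"
proof -
  note u = inv_modulus[OF assms]
  have sum: "s_pair x + cnj (s_pair x) = of_real (- 2 * x / inv_modulus x)"
    by (simp add: s_pair_def complex_eq_iff)
  have "\<bar>x\<bar> < 1" using assms x_min_nonneg by auto
  then have "x ^ 2 \<le> 1" by (simp add: abs_square_le_1)
  then have prod: "s_pair x * cnj (s_pair x) = of_real (1 / inv_modulus x ^ 2)"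
    by (simp add: s_pair_def complex_eq_iff power2_eq_square add_divide_distrib[symmetric])
  show "s_pair x + cnj (s_pair x) + s_third x = - 1"
  proof -
    have "- 2 * x / inv_modulus x + (2 * x - inv_modulus x) / inv_modulus x = - 1" using u(1) by (simp add: divide_simps)
    then show ?thesis unfolding sum s_third_def of_real_add[symmetric] by simp
  qed
  have "s_pair x * cnj (s_pair x) + s_pair x * s_third x + cnj (s_pair x) * s_third x = s_pair x * cnj (s_pair x) + (s_pair x + cnj (s_pair x)) * s_third x"
    by (simp add: algebra_simps)
  also have "\<dots> = of_real (1 / inv_modulus x ^ 2 + (- 2 * x / inv_modulus x) * ((2 * x - inv_modulus x) / inv_modulus x))"
    unfolding sum prod s_third_def of_real_mult of_real_add by simp
  also have "1 / inv_modulus x ^ 2 + (- 2 * x / inv_modulus x) * ((2 * x - inv_modulus x) / inv_modulus x) = a - b * z_at x"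
  proof -
    \<comment> \<open>The cubic equation, arranged so that division by
      \<open>inv_modulus x ^ 3\<close> turns it into the second of Vieta's relations.\<close>
    have P: "inv_modulus x - 4 * x ^ 2 * inv_modulus x + 2 * x * inv_modulus x ^ 2 = a * inv_modulus x ^ 3 - b * (inv_modulus x - 2 * x)"
      using u(4) unfolding gcub_def by (simp add: algebra_simps)
    have "1 / inv_modulus x ^ 2 + (- 2 * x / inv_modulus x) * ((2 * x - inv_modulus x) / inv_modulus x)
        = (inv_modulus x - 4 * x ^ 2 * inv_modulus x + 2 * x * inv_modulus x ^ 2) / inv_modulus x ^ 3"
      using u(1) by (simp add: divide_simps) (simp add: power2_eq_square power3_eq_cube algebra_simps)
    also have "\<dots> = a - b * z_at x"
      unfolding P z_at_def using u(1) by (simp add: diff_divide_distrib[of "a * inv_modulus x ^ 3"])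
    finally show ?thesis .
  qed
  finally show "s_pair x * cnj (s_pair x) + s_pair x * s_third x + cnj (s_pair x) * s_third x = of_real a - of_real b * of_real (z_at x)"
    by simp
  show "s_pair x * cnj (s_pair x) * s_third x = - of_real (z_at x)"
    unfolding prod s_third_def of_real_mult[symmetric] of_real_minus[symmetric] of_real_eq_iff z_at_def
    using u(1) by (simp add: divide_simps power2_eq_square power3_eq_cube)
qed

text \<open>The value z determines the three roots, and \<open>s_pair x\<close> is the only one in
  the upper half plane. Its modulus and real part recover x.\<close>

lemma inj_z_at: "inj_on z_at {x_min<..<1}"
proof (rule inj_onI)
  fix x y assume xy: "x \<in> {x_min<..<1}" "y \<in> {x_min<..<1}" "z_at x = z_at y"
  have x: "x_min < x" "x < 1" and y: "x_min < y" "y < 1" using xy by auto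
  have Im: "Im (s_pair w) > 0" if "x_min < w" "w < 1" for w
  proof -
    have "\<bar>w\<bar> < 1" using that x_min_nonneg by auto
    then have "w ^ 2 < 1" by (simp add: abs_square_less_1)
    then show ?thesis using inv_modulus(1)[OF that] by (simp add: s_pair_def)
  qed
  have "s_pair x = s_pair y \<or> s_pair x = cnj (s_pair y) \<or> s_pair x = s_third y"
    by (rule cubic_roots_unique[of _ "cnj (s_pair x)" "s_third x"]) (simp_all add: vieta[OF x] vieta[OF y] xy)
  moreover have "s_pair x \<noteq> cnj (s_pair y)" "s_pair x \<noteq> s_third y"
    using Im[OF x] Im[OF y] by (auto simp: complex_eq_iff s_third_def)
  ultimately have s: "s_pair x = s_pair y" by simp
  have cmod: "cmod (s_pair w) = 1 / inv_modulus w" if "x_min < w" "w < 1" for w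
  proof -
    have "\<bar>w\<bar> < 1" using that x_min_nonneg by auto
    then have "w ^ 2 \<le> 1" by (simp add: abs_square_le_1)
    then show ?thesis using inv_modulus(1)[OF that] by (simp add: s_pair_def norm_divide complex_norm)
  qed
  have "inv_modulus x = inv_modulus y" using s cmod[OF x] cmod[OF y] by simp
  moreover have "Re (s_pair x) = Re (s_pair y)" using s by simp
  ultimately show "x = y" using inv_modulus(1)[OF x] by (simp add: s_pair_def)
qed

section \<open>Sign changes and the count of real zeros\<close>

lemma angle_less: "k < l \<Longrightarrow> real k * pi / real (m + 2) < real l * pi / real (m + 2)"
  by (intro divide_strict_right_mono mult_strict_right_mono) auto

lemma angle_pi: "real (m + 2) * pi / real (m + 2) = pi"
  by simp

text \<open>
  At \<open>\<theta> = k \<pi> / (m + 2)\<close> the conjugate roots have equal real \<open>(m + 2)\<close>-nd powers, which makes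
  \<open>H m\<close> explicit: \<open>H m * norm (s - t) ^ 2 = t ^ (m + 2) - (-1) ^ k * norm s ^ (m + 2)\<close>.
\<close>
lemma sign_H_z_at:
  assumes "x_min < - cos (k * pi / real (m + 2))" "0 < k" "k < m + 2"
  shows "(-1) ^ k * poly (H a b m) (z_at (- cos (k * pi / real (m + 2)))) < 0"
proof -
  define \<theta> where "\<theta> = k * pi / real (m + 2)"
  define x where "x = - cos \<theta>"
  have \<theta>: "0 < \<theta>" "\<theta> < pi" using assms angle_less[of k "m + 2" m] unfolding angle_pi by (auto simp: \<theta>_def)
  have sin: "sin \<theta> > 0" using \<theta> by (simp add: sin_gt_zero)
  have x: "x_min < x" "x < 1"
    using assms cos_monotone_0_pi[of \<theta> pi] \<theta> by (auto simp: x_def \<theta>_def)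
  note u = inv_modulus[OF x]
  have "sqrt (1 - x ^ 2) = sin \<theta>" using sin by (simp add: x_def sin_squared_eq[symmetric])
  then have s: "s_pair x = cis \<theta> / of_real (inv_modulus x)" by (simp add: s_pair_def x_def cis.ctr)
  have cis: "cis \<theta> ^ (m + 2) = (-1) ^ k"
  proof -
    have "real (m + 2) * \<theta> = k * pi" by (simp add: \<theta>_def)
    then have "cis \<theta> ^ (m + 2) = cis (k * pi)" by (simp only: Complex.DeMoivre)
    also have "\<dots> = cis pi ^ k" unfolding Complex.DeMoivre by simp
    finally show ?thesis by simp
  qed
  have pw: "s_pair x ^ (m + 2) = (-1) ^ k / of_real (inv_modulus x) ^ (m + 2)"
    unfolding s power_divide cis ..
  have pw': "cnj (s_pair x) ^ (m + 2) = (-1) ^ k / of_real (inv_modulus x) ^ (m + 2)"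
    unfolding complex_cnj_power[symmetric] pw by simp
  have "poly (cpoly (H a b m)) (z_at x) * ((s_pair x - cnj (s_pair x)) * (s_pair x - s_third x) * (cnj (s_pair x) - s_third x)) =
    (-1) ^ k / of_real (inv_modulus x) ^ (m + 2) * (cnj (s_pair x) - s_third x)
     - (-1) ^ k / of_real (inv_modulus x) ^ (m + 2) * (s_pair x - s_third x) + s_third x ^ (m + 2) * (s_pair x - cnj (s_pair x))"
    unfolding poly_H_roots[OF vieta[OF x]] pw pw' ..
  then have "(s_pair x - cnj (s_pair x)) * (of_real (poly (H a b m) (z_at x)) * ((s_pair x - s_third x) * (cnj (s_pair x) - s_third x))) =
     (s_pair x - cnj (s_pair x)) * (s_third x ^ (m + 2) - (-1) ^ k / of_real (inv_modulus x) ^ (m + 2))"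
    unfolding poly_cpoly_of_real by (simp only: ring_distribs) (simp add: algebra_simps)
  moreover have "s_pair x - cnj (s_pair x) \<noteq> 0"
    using sin u by (auto simp: s complex_eq_iff)
  ultimately have "of_real (poly (H a b m) (z_at x)) * ((s_pair x - s_third x) * (cnj (s_pair x) - s_third x))
      = s_third x ^ (m + 2) - (-1) ^ k / of_real (inv_modulus x) ^ (m + 2)"
    using mult_left_cancel by blast
  \<comment> \<open>The third root is real, so the two factors are conjugate.\<close>
  moreover have "(s_pair x - s_third x) * (cnj (s_pair x) - s_third x) = of_real (cmod (s_pair x - s_third x) ^ 2)"
    using complex_norm_square[of "s_pair x - s_third x"] by (simp add: s_third_def)
  ultimately have "of_real (poly (H a b m) (z_at x) * cmod (s_pair x - s_third x) ^ 2)
      = complex_of_real (((2 * x - inv_modulus x) / inv_modulus x) ^ (m + 2) - (-1) ^ k / inv_modulus x ^ (m + 2))"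
    by (simp add: s_third_def)
  then have "poly (H a b m) (z_at x) * cmod (s_pair x - s_third x) ^ 2
      = ((2 * x - inv_modulus x) / inv_modulus x) ^ (m + 2) - (-1) ^ k / inv_modulus x ^ (m + 2)"
    unfolding of_real_eq_iff .
  also have "\<dots> = ((2 * x - inv_modulus x) ^ (m + 2) - (-1) ^ k) / inv_modulus x ^ (m + 2)"
    by (simp only: power_divide diff_divide_distrib[of "_ ^ _"])
  finally have eq: "(-1) ^ k * poly (H a b m) (z_at x) * cmod (s_pair x - s_third x) ^ 2
      = ((-1) ^ k * (2 * x - inv_modulus x) ^ (m + 2) - (-1) ^ k * (-1) ^ k) / inv_modulus x ^ (m + 2)"
    by (simp add: algebra_simps)
  \<comment> \<open>The third root is strictly dominated, so its power cannot outweigh the term of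
    modulus 1, which decides the sign.\<close>
  have "\<bar>(2 * x - inv_modulus x) ^ (m + 2)\<bar> < 1"
  proof -
    have "\<bar>2 * x - inv_modulus x\<bar> < 1" using u by auto
    then show ?thesis using power_Suc_less_one[of "\<bar>2 * x - inv_modulus x\<bar>" "m + 1"]
      by (cases "2 * x - inv_modulus x = 0") (simp_all add: abs_mult power_abs)
  qed
  then have "(-1) ^ k * (2 * x - inv_modulus x) ^ (m + 2) < 1"
    by (cases "even k") auto
  then have "((-1) ^ k * (2 * x - inv_modulus x) ^ (m + 2) - (-1) ^ k * (-1) ^ k) / inv_modulus x ^ (m + 2) < 0"
    using u by (intro divide_neg_pos) (auto simp flip: power_mult_distrib)
  then have "(-1) ^ k * poly (H a b m) (z_at x) * cmod (s_pair x - s_third x) ^ 2 < 0" unfolding eq .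
  then show ?thesis
    unfolding x_def \<theta>_def by (simp add: mult_less_0_iff)
qed

text \<open>The signs at consecutive angles differ, so each of the \<open>m + 1 - k0\<close> gaps
  between the angles with index \<open>k0\<close> to \<open>m + 1\<close> contains a zero.
  Injectivity of \<open>z_at\<close> makes the resulting values of z distinct.\<close>

lemma many_real_zeros:
  assumes "x_min < - cos (k0 * pi / real (m + 2))" "0 < k0" "k0 \<le> m + 1"
  obtains R where "finite R" "card R = m + 1 - k0" "\<And>z. z \<in> R \<Longrightarrow> poly (H a b m) z = 0"
proof -
  define X where "X = (\<lambda>k::nat. - cos (k * pi / real (m + 2)))"
  have mono: "X k < X l" if "k < l" "l \<le> m + 2" for k l
  proof -
    have "real l * pi / real (m + 2) \<le> pi"
      using angle_less[of l "m + 2" m] that unfolding angle_pi by (cases "l = m + 2") auto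
    then show ?thesis
      unfolding X_def using angle_less[OF that(1), of m] by (auto intro!: cos_monotone_0_pi)
  qed
  have X0: "x_min < X k" if "k0 \<le> k" "k \<le> m + 1" for k
    using mono[of k0 k] that assms by (cases "k = k0") (auto simp: X_def)
  have X1: "X k < 1" if "k \<le> m + 1" for k
    using mono[of k "m + 2"] that by (simp add: X_def)
  have "\<exists>y. X k < y \<and> y < X (Suc k) \<and> poly (H a b m) (z_at y) = 0" if k: "k \<in> {k0..<m + 1}" for k
  proof -
    \<comment> \<open>The factor \<open>(-1) ^ k\<close> normalizes the change of sign to one from
      negative to positive.\<close>
    define f where "f = (\<lambda>y. (-1) ^ k * poly (H a b m) (z_at y))"
    have f1: "f (X k) < 0" unfolding f_def X_def
      using sign_H_z_at[of k m] X0[of k] k assms by (auto simp: X_def)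
    have "- f (X (Suc k)) < 0" unfolding f_def X_def
      using sign_H_z_at[of "Suc k" m] X0[of "Suc k"] k assms by (auto simp: X_def)
    then have f2: "f (X (Suc k)) > 0" by simp
    have le: "X k \<le> X (Suc k)" using mono[of k "Suc k"] k by auto
    have sub: "{X k..X (Suc k)} \<subseteq> {x_min<..<1}" using X0[of k] X1[of "Suc k"] k by auto
    have cont: "continuous_on {X k..X (Suc k)} f"
      unfolding f_def by (intro continuous_intros continuous_on_subset[OF continuous_z_at sub])
    obtain y where y: "X k \<le> y" "y \<le> X (Suc k)" "f y = 0"
      using IVT'[of f "X k" 0 "X (Suc k)"] f1 f2 le cont by auto
    moreover have "y \<noteq> X k" "y \<noteq> X (Suc k)" using y f1 f2 by auto
    ultimately show ?thesis by (intro exI[of _ y]) (auto simp: f_def)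
  qed
  then obtain Y where Y: "\<And>k. k \<in> {k0..<m + 1} \<Longrightarrow> X k < Y k \<and> Y k < X (Suc k) \<and> poly (H a b m) (z_at (Y k)) = 0"
    by metis
  have Yin: "Y k \<in> {x_min<..<1}" if "k \<in> {k0..<m + 1}" for k
    using Y[OF that] X0[of k] X1[of "Suc k"] that by auto
  have Ymono: "Y k < Y l" if "k \<in> {k0..<m + 1}" "l \<in> {k0..<m + 1}" "k < l" for k l
  proof -
    have "X (Suc k) \<le> X l" using mono[of "Suc k" l] that by (cases "Suc k = l") auto
    then show ?thesis using Y[OF that(1)] Y[OF that(2)] by linarith
  qed
  have "inj_on (\<lambda>k. z_at (Y k)) {k0..<m + 1}"
  proof (rule inj_onI)
    fix k l assume kl: "k \<in> {k0..<m + 1}" "l \<in> {k0..<m + 1}" "z_at (Y k) = z_at (Y l)"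
    then have "Y k = Y l" using inj_onD[OF inj_z_at] Yin by blast
    then show "k = l" using Ymono[of k l] Ymono[of l k] kl by (cases k l rule: linorder_cases) auto
  qed
  then have "card ((\<lambda>k. z_at (Y k)) ` {k0..<m + 1}) = m + 1 - k0"
    by (simp add: card_image)
  then show ?thesis using Y by (intro that[of "(\<lambda>k. z_at (Y k)) ` {k0..<m + 1}"]) auto
qed

text \<open>
  The zeros found number at least one less than the degree; nonreal zeros come in pairs, so none is left.
\<close>
lemma real_rooted_H: "real_rooted (H a b m)"
proof (cases "m \<le> 1")
  case True
  then have "m = 0 \<or> m = 1" by auto
  then show ?thesis using H_1[of a b] by (auto simp: H_0 real_rooted_def cpoly_uminus)
next
  case False
  \<comment> \<open>The least k with \<open>k * pi / (m + 2)\<close> beyond the initial angle, that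
    is, the least integer above \<open>2 * (m + 2) / 3\<close> or above
    \<open>(m + 2) / 2\<close>.\<close>
  define k0 where "k0 = (if b = 0 then (2 * m + 4) div 3 + 1 else m div 2 + 2)"
  have k0: "0 < k0" "k0 \<le> m + 1" using False by (auto simp: k0_def)
  have bound: "x_min < - cos (k0 * pi / real (m + 2))"
  proof (cases "b = 0")
    case True
    have "2 * (m + 2) < 3 * k0" unfolding k0_def using True by simp
    then have "real (2 * (m + 2)) < real (3 * k0)" unfolding of_nat_less_iff .
    then have "2 / 3 * (real m + 2) < real k0" by simp
    then have "2 / 3 * (real m + 2) * pi < real k0 * pi" by (intro mult_strict_right_mono) auto
    then have "2 * pi / 3 < k0 * pi / real (m + 2)" by (simp add: pos_less_divide_eq algebra_simps)
    moreover have "k0 * pi / real (m + 2) \<le> pi"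
      using k0 angle_less[of k0 "m + 2" m] unfolding angle_pi by auto
    ultimately have "cos (k0 * pi / real (m + 2)) < cos (2 * pi / 3)"
      by (intro cos_monotone_0_pi) auto
    then show ?thesis unfolding x_min_def using True by (simp add: cos_120)
  next
    case False
    have "m + 2 < 2 * k0" unfolding k0_def using False by simp
    then have "real (m + 2) < real (2 * k0)" unfolding of_nat_less_iff .
    then have "1 / 2 * (real m + 2) < real k0" by simp
    then have "1 / 2 * (real m + 2) * pi < real k0 * pi" by (intro mult_strict_right_mono) auto
    then have "pi / 2 < k0 * pi / real (m + 2)" by (simp add: pos_less_divide_eq algebra_simps)
    moreover have "k0 * pi / real (m + 2) \<le> pi"
      using k0 angle_less[of k0 "m + 2" m] unfolding angle_pi by auto
    ultimately have "cos (k0 * pi / real (m + 2)) < cos (pi / 2)"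
      by (intro cos_monotone_0_pi) auto
    then show ?thesis unfolding x_min_def using False by simp
  qed
  obtain R where R: "finite R" "card R = m + 1 - k0" "\<And>z. z \<in> R \<Longrightarrow> poly (H a b m) z = 0"
    using many_real_zeros[OF bound k0] by blast
  have "degree (H a b m) \<le> card R + 1"
  proof (cases "b = 0")
    case True
    then have "degree (H a b m) \<le> m div 3" using degree_H_le_0 by simp
    also have "m div 3 \<le> m + 1 - ((2 * m + 4) div 3 + 1) + 1" using False by presburger
    finally show ?thesis using R True by (simp add: k0_def)
  next
    case False
    have "degree (H a b m) \<le> m div 2" by (rule degree_H_le)
    also have "m div 2 \<le> m + 1 - (m div 2 + 2) + 1" using \<open>\<not> m \<le> 1\<close> by presburger
    finally show ?thesis using R False by (simp add: k0_def)
  qed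
  \<comment> \<open>Its value at the first sample angle has a strict sign.\<close>
  moreover have "H a b m \<noteq> 0"
    using sign_H_z_at[OF bound] k0 by auto
  ultimately show ?thesis using real_rootedI_card[of "H a b m" R] R by blast
qed

end

subsection \<open>Necessity\<close>

text \<open>The complex form of \<open>(1 + v / n) ^ n\<close> tending to \<open>exp v\<close>: the
  hypothesis forces \<open>q n\<close> to 1, and \<open>n * Ln (q n)\<close> then tends to v since
  \<open>Ln\<close> has derivative 1 there.\<close>

lemma tendsto_power_exp:
  fixes q :: "nat \<Rightarrow> complex"
  assumes "(\<lambda>n. of_nat n * (q n - 1)) \<longlonglongrightarrow> v"
  shows "(\<lambda>n. q n ^ n) \<longlonglongrightarrow> exp v"
proof -
  have "(\<lambda>n. of_nat n * (q n - 1) * inverse (of_nat n)) \<longlonglongrightarrow> v * 0"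
    by (intro tendsto_mult assms lim_inverse_n)
  moreover have "\<forall>\<^sub>F n in sequentially. of_nat n * (q n - 1) * inverse (of_nat n) = q n - 1"
    using eventually_gt_at_top[of 0] by eventually_elim (simp add: field_simps)
  ultimately have "(\<lambda>n. q n - 1) \<longlonglongrightarrow> 0"
    by (simp add: tendsto_cong)
  then have q: "q \<longlonglongrightarrow> 1" by (simp add: LIM_zero_iff)
  \<comment> \<open>Caratheodory's form of the derivative covers indices with \<open>q n = 1\<close>
    without dividing by \<open>q n - 1\<close>.\<close>
  have "(Ln has_field_derivative 1) (at 1)"
    using has_field_derivative_Ln[of 1] by simp
  then obtain g where g: "\<And>z. Ln z - Ln 1 = g z * (z - 1)" "isCont g 1" "g 1 = 1"
    unfolding CARAT_DERIV by blast
  have "(\<lambda>n. g (q n) * (of_nat n * (q n - 1))) \<longlonglongrightarrow> 1 * v"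
    using isCont_tendsto_compose[OF g(2) q] g(3) assms by (intro tendsto_mult) auto
  then have "(\<lambda>n. exp (g (q n) * (of_nat n * (q n - 1)))) \<longlonglongrightarrow> exp v"
    by (intro tendsto_exp) simp
  moreover have "\<forall>\<^sub>F n in sequentially. exp (g (q n) * (of_nat n * (q n - 1))) = q n ^ n"
    using tendsto_imp_eventually_ne[OF q zero_neq_one[symmetric]]
  proof eventually_elim
    case (elim n)
    have "g (q n) * (of_nat n * (q n - 1)) = of_nat n * Ln (q n)"
      using g(1)[of "q n"] by (simp add: mult.left_commute)
    then have "exp (g (q n) * (of_nat n * (q n - 1))) = exp (of_nat n * Ln (q n))" by (simp only:)
    then show ?case using elim by (simp add: exp_of_nat_mult)
  qed
  ultimately show ?thesis by (rule Lim_transform_eventually)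
qed

section \<open>Continuity and first-order motion of the roots\<close>

lemma closest_root_power_le:
  fixes s :: complex
  assumes "M \<noteq> {#}"
  shows "\<exists>x\<in>#M. norm (s - x) ^ size M \<le> norm (\<Prod>y\<in>#M. s - y)"
  using assms
proof (induction M)
  case (add r M)
  show ?case
  proof (cases "M = {#}")
    case False
    then obtain x where x: "x \<in># M" "norm (s - x) ^ size M \<le> norm (\<Prod>y\<in>#M. s - y)"
      using add.IH by blast
    show ?thesis
    proof (cases "norm (s - x) \<le> norm (s - r)")
      case True
      then show ?thesis
        using x by (intro bexI[of _ x]) (auto simp: norm_mult intro!: mult_mono)
    next
      case False
      then have "norm (s - r) ^ size M \<le> norm (s - x) ^ size M"
        by (intro power_mono) auto
      then show ?thesis
        using x by (intro bexI[of _ r]) (auto simp: norm_mult intro!: mult_left_mono)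
    qed
  qed auto
qed auto

text \<open>The value of a monic cubic at s is the product of the three differences to its roots,
  and the nearest root gives the smallest factor.\<close>

lemma cubic_has_near_root:
  fixes A B s :: complex
  obtains S where "S ^ 3 + S ^ 2 + A * S + B = 0"
    "norm (s - S) ^ 3 \<le> norm (s ^ 3 + s ^ 2 + A * s + B)"
proof -
  define p where "p = [:B, A, 1, 1:]"
  have ev: "poly p z = z ^ 3 + z ^ 2 + A * z + B" for z
    by (simp add: p_def algebra_simps power2_eq_square power3_eq_cube)
  have p: "p \<noteq> 0" "degree p = 3" "lead_coeff p = 1" by (auto simp: p_def)
  obtain M where M: "size M = degree p" "p = smult (lead_coeff p) (\<Prod>x\<in>#M. [:-x, 1:])"
    using alg_closed_imp_factorization[OF p(1)] by blast
  have ev': "poly p z = (\<Prod>x\<in>#M. z - x)" for z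
    using M(2) p(3) by (simp add: poly_prod_mset image_mset.compositionality o_def)
  have "M \<noteq> {#}" using M p by auto
  then obtain S where S: "S \<in># M" "norm (s - S) ^ 3 \<le> norm (\<Prod>y\<in>#M. s - y)"
    using closest_root_power_le[of M s] M p by auto
  have "poly p S = 0" unfolding ev' using S by (auto simp: prod_mset_zero_iff)
  then show ?thesis using S that[of S] unfolding ev'[symmetric] ev by simp
qed

text \<open>The roots with multiplicity of the characteristic cubic, encoded by Vieta's relations
  because \<open>poly_H_roots\<close> takes them in this form.\<close>

definition char_roots :: "real \<Rightarrow> real \<Rightarrow> complex \<Rightarrow> complex \<Rightarrow> complex \<Rightarrow> complex \<Rightarrow> bool" where
  "char_roots a b z s1 s2 s3 \<longleftrightarrow> s1 + s2 + s3 = - 1 \<and>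
     s1 * s2 + s1 * s3 + s2 * s3 = of_real a - of_real b * z \<and> s1 * s2 * s3 = - z"

lemma char_roots_perm:
  assumes "char_roots a b z s1 s2 s3"
  shows "char_roots a b z s2 s1 s3" "char_roots a b z s3 s1 s2"
  using assms unfolding char_roots_def by (simp_all add: algebra_simps)

lemma char_roots_prod:
  assumes "char_roots a b z s1 s2 s3"
  shows "(s - s1) * (s - s2) * (s - s3) = s ^ 3 + s ^ 2 + (of_real a - of_real b * z) * s + z"
proof -
  have "(s - s1) * (s - s2) * (s - s3) = s ^ 3 - (s1 + s2 + s3) * s ^ 2
          + (s1 * s2 + s1 * s3 + s2 * s3) * s - s1 * s2 * s3"
    by (simp add: algebra_simps power3_eq_cube power2_eq_square)
  then show ?thesis using assms unfolding char_roots_def by simp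
qed

text \<open>Subtracting the equations pairwise and cancelling differences of roots, twice, gives the
  sum of the roots; the other relations follow by substitution.\<close>

lemma char_rootsI:
  assumes "s1 \<noteq> s2" "s1 \<noteq> s3" "s2 \<noteq> s3"
    and r: "\<And>s. s \<in> {s1, s2, s3} \<Longrightarrow> s ^ 3 + s ^ 2 + (of_real a - of_real b * z) * s + z = 0"
  shows "char_roots a b z s1 s2 s3"
proof -
  define A where "A = of_real a - of_real b * z"
  have r1: "s1 ^ 3 + s1 ^ 2 + A * s1 + z = 0" and r2: "s2 ^ 3 + s2 ^ 2 + A * s2 + z = 0"
    and r3: "s3 ^ 3 + s3 ^ 2 + A * s3 + z = 0"
    using r unfolding A_def by auto
  have "(s1 - s2) * (s1 ^ 2 + s1 * s2 + s2 ^ 2 + s1 + s2 + A) =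
     (s1 ^ 3 + s1 ^ 2 + A * s1 + z) - (s2 ^ 3 + s2 ^ 2 + A * s2 + z)"
    by (simp add: algebra_simps power3_eq_cube power2_eq_square)
  then have 2: "s1 ^ 2 + s1 * s2 + s2 ^ 2 + s1 + s2 + A = 0"
    using r1 r2 assms(1) by simp
  have "(s1 - s3) * (s1 ^ 2 + s1 * s3 + s3 ^ 2 + s1 + s3 + A) =
     (s1 ^ 3 + s1 ^ 2 + A * s1 + z) - (s3 ^ 3 + s3 ^ 2 + A * s3 + z)"
    by (simp add: algebra_simps power3_eq_cube power2_eq_square)
  then have 3: "s1 ^ 2 + s1 * s3 + s3 ^ 2 + s1 + s3 + A = 0"
    using r1 r3 assms(2) by simp
  have "(s2 - s3) * (s1 + s2 + s3 + 1) =
     (s1 ^ 2 + s1 * s2 + s2 ^ 2 + s1 + s2 + A) - (s1 ^ 2 + s1 * s3 + s3 ^ 2 + s1 + s3 + A)"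
    by (simp add: algebra_simps power2_eq_square)
  then have "s1 + s2 + s3 + 1 = 0" using 2 3 assms(3) by simp
  then have s3: "s3 = - 1 - s1 - s2" by (simp add: algebra_simps add_eq_0_iff)
  have A: "A = - (s1 ^ 2 + s1 * s2 + s2 ^ 2 + s1 + s2)" using 2 by (rule minus_unique[symmetric])
  have z: "z = - (s1 ^ 3 + s1 ^ 2 + A * s1)" using r1 by (rule minus_unique[symmetric])
  show ?thesis
    unfolding char_roots_def A_def[symmetric] unfolding z A s3
    by (simp add: algebra_simps power3_eq_cube power2_eq_square)
qed

text \<open>The perturbed cubic takes values tending to 0 at the old root s, so its root nearest to
  s tends to s.\<close>

lemma root_sequence:
  fixes s z0 w :: complex and a b :: real
  assumes "s ^ 3 + s ^ 2 + (of_real a - of_real b * z0) * s + z0 = 0"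
  obtains S where "S \<longlonglongrightarrow> s"
    "\<And>n. S n ^ 3 + S n ^ 2 + (of_real a - of_real b * (z0 + w / of_nat n)) * S n + (z0 + w / of_nat n) = 0"
proof -
  let ?p = "\<lambda>n s. s ^ 3 + s ^ 2 + (of_real a - of_real b * (z0 + w / of_nat n)) * s + (z0 + w / of_nat n)"
  have "\<exists>S. ?p n S = 0 \<and> norm (s - S) ^ 3 \<le> norm (?p n s)" for n
    using cubic_has_near_root[of "of_real a - of_real b * (z0 + w / of_nat n)" "z0 + w / of_nat n" s] by metis
  then obtain S where S: "\<And>n. ?p n (S n) = 0" "\<And>n. norm (s - S n) ^ 3 \<le> norm (?p n s)"
    by metis
  have wn: "(\<lambda>n. w / of_nat n) \<longlonglongrightarrow> 0" by (rule lim_const_over_n)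
  have "(\<lambda>n. ?p n s) \<longlonglongrightarrow> s ^ 3 + s ^ 2 + (of_real a - of_real b * (z0 + 0)) * s + (z0 + 0)"
    by (intro tendsto_intros wn)
  then have "(\<lambda>n. norm (?p n s)) \<longlonglongrightarrow> 0"
    using assms tendsto_norm_zero by fastforce
  then have "(\<lambda>n. norm (s - S n) ^ 3) \<longlonglongrightarrow> 0"
    by (rule tendsto_sandwich[OF _ _ tendsto_const, rotated 2]) (use S in auto)
  then have "(\<lambda>n. root 3 (norm (s - S n) ^ 3)) \<longlonglongrightarrow> root 3 0"
    by (rule tendsto_real_root)
  then have "(\<lambda>n. norm (s - S n)) \<longlonglongrightarrow> 0"
    by (simp add: real_root_power_cancel)
  then have "(\<lambda>n. s - S n) \<longlonglongrightarrow> 0" by (simp add: tendsto_norm_zero_iff)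
  then have "(\<lambda>n. s - (s - S n)) \<longlonglongrightarrow> s - 0" by (intro tendsto_intros)
  then have "S \<longlonglongrightarrow> s" by simp
  then show ?thesis using S that by blast
qed

text \<open>Here \<open>\<nu>\<close> is the logarithmic derivative of the root \<open>s1\<close>
  with respect to z, found by implicit differentiation of the cubic. Thus \<open>S1 n / s1\<close>
  is \<open>1 + \<nu> * w / n\<close> to first order.\<close>

lemma root_drift:
  assumes s: "char_roots a b z0 s1 s2 s3"
    and S: "\<forall>\<^sub>F n in sequentially. char_roots a b (z0 + w / of_nat n) (S1 n) (S2 n) (S3 n)"
    and lim: "S2 \<longlonglongrightarrow> s2" "S3 \<longlonglongrightarrow> s3"
    and ne: "s1 \<noteq> 0" "s1 \<noteq> s2" "s1 \<noteq> s3"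
    and \<nu>: "\<nu> * (s1 * ((s1 - s2) * (s1 - s3))) = - (1 - of_real b * s1)"
  shows "(\<lambda>n. (S1 n / s1) ^ n) \<longlonglongrightarrow> exp (\<nu> * w)"
proof (rule tendsto_power_exp)
  let ?D = "\<lambda>n. s1 * ((s1 - S2 n) * (s1 - S3 n))"
  have D: "?D \<longlonglongrightarrow> s1 * ((s1 - s2) * (s1 - s3))"
    by (intro tendsto_intros lim)
  have D0: "s1 * ((s1 - s2) * (s1 - s3)) \<noteq> 0" using ne by simp
  have "(\<lambda>n. - (1 - of_real b * s1) * w / ?D n) \<longlonglongrightarrow> - (1 - of_real b * s1) * w / (s1 * ((s1 - s2) * (s1 - s3)))"
    by (intro tendsto_intros lim D0)
  also have "- (1 - of_real b * s1) * w / (s1 * ((s1 - s2) * (s1 - s3))) = \<nu> * w"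
    unfolding \<nu>[symmetric] using D0 by simp
  finally have "(\<lambda>n. - (1 - of_real b * s1) * w / ?D n) \<longlonglongrightarrow> \<nu> * w" .
  moreover have "\<forall>\<^sub>F n in sequentially. - (1 - of_real b * s1) * w / ?D n = of_nat n * (S1 n / s1 - 1)"
    using S tendsto_imp_eventually_ne[OF D D0] eventually_gt_at_top[of 0]
  proof eventually_elim
    case (elim n)
    \<comment> \<open>Evaluating the perturbed cubic at the old root gives an exact equation for
      \<open>s1 - S1 n\<close>, with no error term to estimate.\<close>
    have "(s1 - S1 n) * (s1 - S2 n) * (s1 - S3 n)
        = s1 ^ 3 + s1 ^ 2 + (of_real a - of_real b * (z0 + w / of_nat n)) * s1 + (z0 + w / of_nat n)"
      by (rule char_roots_prod[OF elim(1)])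
    also have "\<dots> = (s1 ^ 3 + s1 ^ 2 + (of_real a - of_real b * z0) * s1 + z0) + w / of_nat n * (1 - of_real b * s1)"
      by (simp add: algebra_simps)
    also have "s1 ^ 3 + s1 ^ 2 + (of_real a - of_real b * z0) * s1 + z0 = 0"
      unfolding char_roots_prod[OF s, symmetric] by simp
    finally have e: "(s1 - S1 n) * (s1 - S2 n) * (s1 - S3 n) = w / of_nat n * (1 - of_real b * s1)" by simp
    have "of_nat n * (S1 n / s1 - 1) * ?D n = - (of_nat n * ((s1 - S1 n) * (s1 - S2 n) * (s1 - S3 n)))"
      using ne by (simp add: diff_divide_eq_iff right_diff_distrib left_diff_distrib)
    also have "\<dots> = - (1 - of_real b * s1) * w"
      unfolding e using elim(3) by (simp add: algebra_simps)
    finally show ?case using elim(2) by (simp add: divide_eq_eq)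
  qed
  ultimately show "(\<lambda>n. of_nat n * (S1 n / s1 - 1)) \<longlonglongrightarrow> \<nu> * w"
    by (rule Lim_transform_eventually)
qed

text \<open>Each root power splits as \<open>(s / r) ^ n * (S n / s) ^ n\<close>. The second factor
  converges by \<open>root_drift\<close>; the first only rotates when r is the modulus of s, which
  is why a subsequence \<open>N\<close> is taken. The index \<open>N k - 2\<close> compensates the
  exponent \<open>m + 2\<close> in \<open>poly_H_roots\<close>.\<close>

lemma H_scaling_limit:
  fixes r :: real
  assumes s: "char_roots a b z0 s1 s2 s3"
    and ne: "s1 \<noteq> 0" "s2 \<noteq> 0" "s3 \<noteq> 0" "s1 \<noteq> s2" "s1 \<noteq> s3" "s2 \<noteq> s3"
    and l1: "\<nu>1 * (s1 * ((s1 - s2) * (s1 - s3))) = - (1 - of_real b * s1)"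
    and l2: "\<nu>2 * (s2 * ((s2 - s1) * (s2 - s3))) = - (1 - of_real b * s2)"
    and l3: "\<nu>3 * (s3 * ((s3 - s1) * (s3 - s2))) = - (1 - of_real b * s3)"
    and N: "filterlim N at_top sequentially"
    and k: "(\<lambda>k. (s1 / of_real r) ^ N k) \<longlonglongrightarrow> \<kappa>1" "(\<lambda>k. (s2 / of_real r) ^ N k) \<longlonglongrightarrow> \<kappa>2"
      "(\<lambda>k. (s3 / of_real r) ^ N k) \<longlonglongrightarrow> \<kappa>3"
  shows "(\<lambda>k. poly (cpoly (H a b (N k - 2))) (z0 + w / of_nat (N k)) / of_real r ^ N k) \<longlonglongrightarrow>
    (\<kappa>1 * exp (\<nu>1 * w) * (s2 - s3) - \<kappa>2 * exp (\<nu>2 * w) * (s1 - s3) + \<kappa>3 * exp (\<nu>3 * w) * (s1 - s2))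
     / ((s1 - s2) * (s1 - s3) * (s2 - s3))"
proof -
  have root: "s ^ 3 + s ^ 2 + (of_real a - of_real b * z0) * s + z0 = 0" if "s \<in> {s1, s2, s3}" for s
    using that unfolding char_roots_prod[OF s, symmetric] by auto
  let ?z = "\<lambda>n. z0 + w / of_nat n"
  let ?p = "\<lambda>n s. s ^ 3 + s ^ 2 + (of_real a - of_real b * ?z n) * s + ?z n"
  obtain S1 where S1: "S1 \<longlonglongrightarrow> s1" "\<And>n. ?p n (S1 n) = 0"
    using root_sequence[OF root, of s1 w] by blast
  obtain S2 where S2: "S2 \<longlonglongrightarrow> s2" "\<And>n. ?p n (S2 n) = 0"
    using root_sequence[OF root, of s2 w] by blast
  obtain S3 where S3: "S3 \<longlonglongrightarrow> s3" "\<And>n. ?p n (S3 n) = 0"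
    using root_sequence[OF root, of s3 w] by blast
  have ev_ne: "\<forall>\<^sub>F n in sequentially. X n \<noteq> Y n" if "X \<longlonglongrightarrow> x" "Y \<longlonglongrightarrow> y" "x \<noteq> y"
    for X Y :: "nat \<Rightarrow> complex" and x y
  proof -
    have "(\<lambda>n. X n - Y n) \<longlonglongrightarrow> x - y" by (intro tendsto_intros that)
    then have "\<forall>\<^sub>F n in sequentially. X n - Y n \<noteq> 0"
      using that by (intro tendsto_imp_eventually_ne) auto
    then show ?thesis by eventually_elim simp
  qed
  \<comment> \<open>Eventual distinctness both yields Vieta's relations and permits division by the
    Vandermonde product.\<close>
  have ev: "\<forall>\<^sub>F n in sequentially. S1 n \<noteq> S2 n" "\<forall>\<^sub>F n in sequentially. S1 n \<noteq> S3 n"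
    "\<forall>\<^sub>F n in sequentially. S2 n \<noteq> S3 n"
    using ev_ne S1(1) S2(1) S3(1) ne by blast+
  then have S: "\<forall>\<^sub>F n in sequentially. char_roots a b (?z n) (S1 n) (S2 n) (S3 n)"
    by eventually_elim (rule char_rootsI, use S1 S2 S3 in auto)
  have lim1: "(\<lambda>n. (S1 n / s1) ^ n) \<longlonglongrightarrow> exp (\<nu>1 * w)"
    by (rule root_drift[OF s S S2(1) S3(1) _ _ _ l1]) (use ne in auto)
  have lim2: "(\<lambda>n. (S2 n / s2) ^ n) \<longlonglongrightarrow> exp (\<nu>2 * w)"
    by (rule root_drift[OF char_roots_perm(1)[OF s] eventually_mono[OF S char_roots_perm(1)] S1(1) S3(1) _ _ _ l2])
      (use ne in auto)
  have lim3: "(\<lambda>n. (S3 n / s3) ^ n) \<longlonglongrightarrow> exp (\<nu>3 * w)"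
    by (rule root_drift[OF char_roots_perm(2)[OF s] eventually_mono[OF S char_roots_perm(2)] S1(1) S2(1) _ _ _ l3])
      (use ne in auto)
  let ?V = "\<lambda>n. (S1 n - S2 n) * (S1 n - S3 n) * (S2 n - S3 n)"
  let ?L = "\<lambda>n. ((s1 / of_real r) ^ n * (S1 n / s1) ^ n * (S2 n - S3 n)
        - (s2 / of_real r) ^ n * (S2 n / s2) ^ n * (S1 n - S3 n)
        + (s3 / of_real r) ^ n * (S3 n / s3) ^ n * (S1 n - S2 n)) / ?V n"
  have "\<forall>\<^sub>F n in sequentially. ?L n = poly (cpoly (H a b (n - 2))) (?z n) / of_real r ^ n"
    using S ev eventually_ge_at_top[of 2]
  proof eventually_elim
    case (elim n)
    have c: "(s / of_real r) ^ n * (x / s) ^ n = x ^ n / of_real r ^ n" if "s \<noteq> 0" for s x :: complex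
      using that by (simp add: power_divide)
    have nn: "n - 2 + 2 = n" using elim by simp
    have "poly (cpoly (H a b (n - 2))) (?z n) * ?V n = 
       S1 n ^ n * (S2 n - S3 n) - S2 n ^ n * (S1 n - S3 n) + S3 n ^ n * (S1 n - S2 n)"
      using poly_H_roots[of "S1 n" "S2 n" "S3 n" a b "?z n" "n - 2"] elim
      unfolding char_roots_def nn by blast
    then have "poly (cpoly (H a b (n - 2))) (?z n) =
       (S1 n ^ n * (S2 n - S3 n) - S2 n ^ n * (S1 n - S3 n) + S3 n ^ n * (S1 n - S2 n)) / ?V n"
      using elim by (simp add: eq_divide_eq)
    moreover have "(X1 / R * D1 - X2 / R * D2 + X3 / R * D3) / V = (X1 * D1 - X2 * D2 + X3 * D3) / V / R"
      for X1 X2 X3 D1 D2 D3 R V :: complex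
      by (simp add: add_divide_distrib diff_divide_distrib mult.commute[of R])
    ultimately show ?case
      unfolding c[OF ne(1)] c[OF ne(2)] c[OF ne(3)] by simp
  qed
  then have "\<forall>\<^sub>F k in sequentially. ?L (N k) = poly (cpoly (H a b (N k - 2))) (?z (N k)) / of_real r ^ N k"
    using N by (rule eventually_compose_filterlim)
  moreover have "(\<lambda>k. ?L (N k)) \<longlonglongrightarrow> 
    (\<kappa>1 * exp (\<nu>1 * w) * (s2 - s3) - \<kappa>2 * exp (\<nu>2 * w) * (s1 - s3) + \<kappa>3 * exp (\<nu>3 * w) * (s1 - s2))
     / ((s1 - s2) * (s1 - s3) * (s2 - s3))"
    using ne by (intro tendsto_intros k filterlim_compose[OF lim1 N] filterlim_compose[OF lim2 N]
      filterlim_compose[OF lim3 N] filterlim_compose[OF S1(1) N] filterlim_compose[OF S2(1) N] filterlim_compose[OF S3(1) N]) auto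
  ultimately show ?thesis by (rule Lim_transform_eventually[rotated])
qed

text \<open>
  The real point is chosen so that both exponentials are equal, positive and small there; moving up by
  \<open>\<pi> / Re \<mu>\<close> makes both negative.
\<close>
lemma exp_sum_not_minimal_on_reals:
  fixes C \<mu> :: complex
  assumes "C \<noteq> 0" "Re \<mu> < 0" "Im \<mu> \<noteq> 0"
  obtains x y where "norm (1 + C * exp (\<mu> * Complex x y) + cnj C * exp (cnj \<mu> * Complex x y))
     < norm (1 + C * exp (\<mu> * of_real x) + cnj C * exp (cnj \<mu> * of_real x))"
proof -
  define \<alpha> \<beta> \<phi> where "\<alpha> = Re \<mu>" and "\<beta> = Im \<mu>" and "\<phi> = Arg C"
  define y where "y = pi / \<alpha>"
  define c where "c = exp (\<beta> * y) + exp (- \<beta> * y)"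
  have c: "c > 0" by (simp add: c_def add_pos_pos)
  \<comment> \<open>From this threshold on, \<open>norm C * exp (\<alpha> * x) * c\<close> is at
    most 1.\<close>
  define X where "X = ln (1 / (norm C * c)) / \<alpha>"
  obtain n :: nat where n: "(X + \<phi> / \<beta>) * \<bar>\<beta>\<bar> / (2 * pi) \<le> n" using real_arch_simple by blast
  \<comment> \<open>This makes \<open>\<phi> + \<beta> * x\<close> a multiple of 2\<pi>, so
    \<open>C * exp (\<mu> * x)\<close> is real and positive; n was taken large enough for
    \<open>X \<le> x\<close>.\<close>
  define x where "x = 2 * pi * n / \<bar>\<beta>\<bar> - \<phi> / \<beta>"
  define R where "R = norm C * exp (\<alpha> * x)"
  have \<beta>: "\<beta> \<noteq> 0" and \<alpha>: "\<alpha> < 0" using assms by (auto simp: \<alpha>_def \<beta>_def)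
  have "(X + \<phi> / \<beta>) * \<bar>\<beta>\<bar> \<le> 2 * pi * n"
    using n by (simp add: pos_divide_le_eq mult.commute)
  then have "X + \<phi> / \<beta> \<le> 2 * pi * n / \<bar>\<beta>\<bar>"
    using \<beta> by (simp add: pos_le_divide_eq)
  then have "X \<le> x" unfolding x_def by simp
  then have "\<alpha> * x \<le> \<alpha> * X" using \<alpha> by simp
  then have "exp (\<alpha> * x) \<le> exp (ln (1 / (norm C * c)))" using \<alpha> by (simp add: X_def)
  then have "exp (\<alpha> * x) \<le> 1 / (norm C * c)" using c assms by simp
  then have Rc: "R * c \<le> 1" using c assms by (simp add: R_def field_simps)
  have R: "R > 0" using assms by (simp add: R_def)
  have \<mu>: "\<mu> = Complex \<alpha> \<beta>" by (simp add: \<alpha>_def \<beta>_def)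
  have Ceq: "C * exp (\<mu> * of_real x) = of_real R"
  proof -
    have "C = of_real (norm C) * cis \<phi>" unfolding \<phi>_def
      using rcis_cmod_Arg[of C] by (simp add: rcis_def)
    moreover have "exp (\<mu> * of_real x) = of_real (exp (\<alpha> * x)) * cis (\<beta> * x)"
      by (simp add: exp_eq_polar \<mu>)
    moreover have "cis \<phi> * cis (\<beta> * x) = 1"
    proof -
      have "\<phi> + \<beta> * x = 2 * pi * (sgn \<beta> * n)"
        using \<beta> by (simp add: x_def sgn_if field_simps)
      moreover have "sgn \<beta> * n \<in> \<int>" by (simp add: sgn_if)
      ultimately show ?thesis by (simp only: cis_mult cis_multiple_2pi)
    qed
    ultimately show ?thesis unfolding R_def by (metis (no_types, lifting) mult.assoc mult.commute mult_1_right of_real_mult)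
  qed
  have Ceq': "cnj C * exp (cnj \<mu> * of_real x) = of_real R"
    using arg_cong[OF Ceq, of cnj] by (simp add: exp_cnj)
  have split: "exp (\<nu> * Complex x y) = exp (\<nu> * of_real x) * exp (\<nu> * (\<i> * of_real y))" for \<nu>
    by (simp add: exp_add[symmetric] algebra_simps Complex_eq)
  have ay: "\<alpha> * y = pi" using \<alpha> by (simp add: y_def)
  have e1: "exp (\<mu> * (\<i> * of_real y)) = - of_real (exp (- \<beta> * y))"
  proof -
    have "\<mu> * (\<i> * of_real y) = Complex (- \<beta> * y) pi" unfolding \<mu> using ay by (simp add: complex_eq_iff)
    then show ?thesis by (simp add: exp_eq_polar)
  qed
  have e2: "exp (cnj \<mu> * (\<i> * of_real y)) = - of_real (exp (\<beta> * y))"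
  proof -
    have "cnj \<mu> * (\<i> * of_real y) = Complex (\<beta> * y) pi" unfolding \<mu> using ay by (simp add: complex_eq_iff)
    then show ?thesis by (simp add: exp_eq_polar)
  qed
  have "1 + C * exp (\<mu> * Complex x y) + cnj C * exp (cnj \<mu> * Complex x y) = of_real (1 - R * c)"
    unfolding split e1 e2 unfolding mult.assoc[symmetric] Ceq Ceq' by (simp add: c_def algebra_simps)
  moreover have "1 + C * exp (\<mu> * of_real x) + cnj C * exp (cnj \<mu> * of_real x) = of_real (1 + 2 * R)"
    unfolding Ceq Ceq' by simp
  moreover have "\<bar>1 - R * c\<bar> < \<bar>1 + 2 * R\<bar>" using R Rc mult_pos_pos[OF R c] by linarith
  ultimately show ?thesis using that[of x y] by (simp only: norm_of_real)
qed

text \<open>\<open>\<nu>\<close> and \<open>q\<close> are the logarithmic derivatives in z of the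
  roots \<open>s1\<close> and \<open>p\<close>. If all \<open>H a b m\<close> were real-rooted, the
  scaling limit would inherit minimality of the modulus on the real axis. Dividing by the term with
  the real frequency \<open>q\<close> leaves the sum treated in
  \<open>exp_sum_not_minimal_on_reals\<close>.\<close>

lemma not_real_rooted_of_equimodular:
  fixes a b z0 r p :: real and e \<mu> :: complex
  assumes roots: "char_roots a b z0 s1 (cnj s1) (of_real p)"
    and r: "r > 0" "norm s1 = r" "\<bar>p\<bar> = r" and Im: "Im s1 \<noteq> 0"
    and \<nu>: "\<nu> * (s1 * ((s1 - cnj s1) * (s1 - of_real p))) = - (1 - of_real b * s1)"
    and q: "of_real q * (of_real p * ((of_real p - s1) * (of_real p - cnj s1))) = - (1 - of_real b * of_real p)"
    and Re_less: "Re \<nu> < q" and Im_ne: "Im \<nu> \<noteq> 0"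
  shows "\<exists>m. \<not> real_rooted (H a b m)"
proof (rule ccontr)
  assume "\<not> (\<exists>m. \<not> real_rooted (H a b m))"
  then have rr: "real_rooted (H a b m)" for m by blast
  define e where "e = s1 / of_real r"
  have "norm e = 1" using r by (simp add: e_def norm_divide)
  \<comment> \<open>Compactness of the circle makes the rotating factors converge. Even exponents
    are used so that the powers of \<open>p / r\<close> are 1 also when
    \<open>p = - r\<close>.\<close>
  then have "\<forall>n. (e ^ 2) ^ n \<in> sphere 0 1" by (simp add: norm_power)
  then obtain \<kappa> f where f: "strict_mono f" "\<kappa> \<in> sphere 0 1" "((\<lambda>n. (e ^ 2) ^ n) \<circ> f) \<longlonglongrightarrow> \<kappa>"
    using compact_sphere[of "0::complex" 1] unfolding compact_def by metis
  define N where "N = (\<lambda>k. 2 * f k)"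
  have N: "filterlim N at_top sequentially"
    unfolding N_def using filterlim_subseq[OF f(1)]
    by (rule filterlim_at_top_mono) (simp add: always_eventually)
  have k1: "(\<lambda>k. (s1 / of_real r) ^ N k) \<longlonglongrightarrow> \<kappa>"
    using f(3) unfolding N_def o_def e_def power_mult[symmetric] .
  have k2: "(\<lambda>k. (cnj s1 / of_real r) ^ N k) \<longlonglongrightarrow> cnj \<kappa>"
    using tendsto_cnj[OF k1] by simp
  have "\<bar>p / r\<bar> = 1" using r by simp
  then have "(p / r) ^ 2 = 1" by (metis power2_abs power_one)
  then have "(of_real p / of_real r :: complex) ^ N k = 1" for k
    unfolding N_def power_mult by (metis of_real_1 of_real_divide of_real_power power_one)
  then have k3: "(\<lambda>k. (of_real p / of_real r :: complex) ^ N k) \<longlonglongrightarrow> 1" by simp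
  have ne: "s1 \<noteq> 0" "cnj s1 \<noteq> 0" "complex_of_real p \<noteq> 0" "s1 \<noteq> cnj s1" "s1 \<noteq> of_real p" "cnj s1 \<noteq> of_real p"
    using r Im by (auto simp: complex_eq_iff)
  have \<nu>': "cnj \<nu> * (cnj s1 * ((cnj s1 - s1) * (cnj s1 - of_real p))) = - (1 - of_real b * cnj s1)"
    using arg_cong[OF \<nu>, of cnj] by simp
  define V where "V = (s1 - cnj s1) * (s1 - of_real p) * (cnj s1 - of_real p)"
  have V: "V \<noteq> 0" using ne by (simp add: V_def)
  define T where "T = (\<lambda>w. \<kappa> * exp (\<nu> * w) * (cnj s1 - of_real p)
    - cnj \<kappa> * exp (cnj \<nu> * w) * (s1 - of_real p) + 1 * exp (of_real q * w) * (s1 - cnj s1))"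
  have lim: "(\<lambda>k. poly (cpoly (H a b (N k - 2))) (z0 + w / of_nat (N k)) / of_real r ^ N k) \<longlonglongrightarrow> T w / V" for w :: complex
    unfolding T_def V_def by (rule H_scaling_limit[OF roots ne \<nu> \<nu>' q N k1 k2 k3])
  have T_le: "norm (T (of_real x)) \<le> norm (T (Complex x y))" for x y
  proof -
    have "norm (T (of_real x) / V) \<le> norm (T (Complex x y) / V)"
    proof (rule LIMSEQ_le[OF tendsto_norm[OF lim] tendsto_norm[OF lim]], intro exI allI impI)
      fix k
      have 1: "complex_of_real z0 + complex_of_real x / of_nat (N k) = of_real (z0 + x / N k)" by simp
      \<comment> \<open>The scaled argument keeps its real part, so the comparison along vertical
        lines applies for every k.\<close>
      have 2: "complex_of_real z0 + Complex x y / of_nat (N k) = Complex (z0 + x / N k) (y / N k)"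
        by (simp add: complex_eq_iff Re_divide_of_nat Im_divide_of_nat)
      have "norm (poly (cpoly (H a b (N k - 2))) (of_real (z0 + x / N k)))
         \<le> norm (poly (cpoly (H a b (N k - 2))) (Complex (z0 + x / N k) (y / N k)))"
        by (rule norm_poly_real_rooted_ge[OF rr])
      then show "norm (poly (cpoly (H a b (N k - 2))) (z0 + complex_of_real x / of_nat (N k)) / of_real r ^ N k)
         \<le> norm (poly (cpoly (H a b (N k - 2))) (z0 + Complex x y / of_nat (N k)) / of_real r ^ N k)"
        unfolding norm_divide 1 2 by (rule divide_right_mono) simp
    qed
    then show ?thesis using V by (simp add: norm_divide divide_le_cancel)
  qed
  define \<mu> where "\<mu> = \<nu> - of_real q"
  define C where "C = \<kappa> * (cnj s1 - of_real p) / (s1 - cnj s1)"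
  \<comment> \<open>Since \<open>s1 - cnj s1\<close> is purely imaginary, conjugation changes its
    sign; this produces the minus sign of the middle term of \<open>T\<close>.\<close>
  have cnjC: "cnj C = - (cnj \<kappa> * (s1 - of_real p) / (s1 - cnj s1))"
  proof -
    have c: "cnj (s1 - cnj s1) = - (s1 - cnj s1)" by simp
    show ?thesis unfolding C_def complex_cnj_divide c divide_minus_right by simp
  qed
  have T: "T w = (s1 - cnj s1) * exp (of_real q * w) * (1 + C * exp (\<mu> * w) + cnj C * exp (cnj \<mu> * w))" for w
  proof -
    have e: "exp (\<nu> * w) = exp (of_real q * w) * exp (\<mu> * w)" "exp (cnj \<nu> * w) = exp (of_real q * w) * exp (cnj \<mu> * w)"
      unfolding \<mu>_def exp_add[symmetric] by (simp_all add: algebra_simps)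
    have C: "(s1 - cnj s1) * C = \<kappa> * (cnj s1 - of_real p)" "(s1 - cnj s1) * cnj C = - (cnj \<kappa> * (s1 - of_real p))"
      unfolding cnjC using ne by (simp_all add: C_def)
    have "(s1 - cnj s1) * E * (1 + C * F + cnj C * G) =
       (s1 - cnj s1) * E + ((s1 - cnj s1) * C) * (E * F) + ((s1 - cnj s1) * cnj C) * (E * G)" for E F G
      by (simp add: algebra_simps)
    moreover have "(s1 - cnj s1) * E + ((s1 - cnj s1) * C) * (E * F) + ((s1 - cnj s1) * cnj C) * (E * G) = \<kappa> * (E * F) * (cnj s1 - of_real p) - cnj \<kappa> * (E * G) * (s1 - of_real p) + 1 * E * (s1 - cnj s1)" for E F G
      unfolding C by (simp add: algebra_simps)
    ultimately show ?thesis unfolding T_def e by (simp only:)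
  qed
  have "C \<noteq> 0" using ne f(2) by (auto simp: C_def)
  moreover have "Re \<mu> < 0" "Im \<mu> \<noteq> 0" using Re_less Im_ne by (auto simp: \<mu>_def)
  ultimately obtain x y where xy: "norm (1 + C * exp (\<mu> * Complex x y) + cnj C * exp (cnj \<mu> * Complex x y))
     < norm (1 + C * exp (\<mu> * of_real x) + cnj C * exp (cnj \<mu> * of_real x))"
    using exp_sum_not_minimal_on_reals by blast
  \<comment> \<open>As \<open>q\<close> is real, the modulus of \<open>exp (q * w)\<close> depends
    only on \<open>Re w\<close> and cancels.\<close>
  have "norm (T (Complex x y)) < norm (T (of_real x))"
    unfolding T norm_mult norm_exp_eq_Re using xy ne by simp
  then show False using T_le[of x y] by simp
qed

text \<open>
  The hypothesis on \<open>u\<close> says that all three roots have modulus \<open>1 / u\<close> at \<open>z = - \<epsilon> / u^3\<close>, the real one being \<open>\<epsilon> / u\<close>.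
\<close>
lemma not_real_rooted_of_crossing:
  fixes a b u \<epsilon> :: real
  assumes \<epsilon>: "\<epsilon> = 1 \<or> \<epsilon> = - 1" and u: "u > 0" "\<bar>u + \<epsilon>\<bar> < 2" and b: "b \<ge> 0"
    and eq: "u ^ 2 + b + \<epsilon> * a * u ^ 3 = 0"
  shows "\<exists>m. \<not> real_rooted (H a b m)"
proof -
  \<comment> \<open>The roots must sum to -1, that is
    \<open>- 2 * x / u + \<epsilon> / u = - 1\<close>, which fixes x; the bound on
    \<open>u + \<epsilon>\<close> makes the pair nonreal.\<close>
  define x y where "x = (u + \<epsilon>) / 2" and "y = sqrt (1 - x ^ 2)"
  have "\<bar>x\<bar> < 1" using u by (simp add: x_def)
  then have "x ^ 2 < 1" by (simp add: abs_square_less_1)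
  then have y: "y > 0" "y ^ 2 = 1 - x ^ 2" by (simp_all add: y_def)
  define s1 where "s1 = Complex (- x / u) (y / u)"
  have k: "3 + \<epsilon> * u > 0" "1 - \<epsilon> * u > 0" using \<epsilon> u by auto
  have y2: "y * y = (3 + \<epsilon> * u) * (1 - \<epsilon> * u) / 4"
    using y(2) \<epsilon> by (auto simp: x_def power2_eq_square field_simps)
  \<comment> \<open>The logarithmic derivatives of the roots at the crossing, solved for explicitly:
    \<open>Complex A B\<close> for \<open>s1\<close> and \<open>q\<close> for the real root.\<close>
  define A B q where "A = - (u ^ 3 * (u + 2 * \<epsilon> + b / u) / (2 * (3 + \<epsilon> * u)))"
    and "B = u ^ 3 * \<epsilon> * (u + b / u) / (4 * y)"
    and "q = - (u ^ 3 * (\<epsilon> - b / u) / (3 + \<epsilon> * u))"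
  show ?thesis
  proof (rule not_real_rooted_of_equimodular[of a b "- \<epsilon> / u ^ 3" s1 "\<epsilon> / u" "1 / u" "Complex A B" q])
    have ss: "s1 + cnj s1 = of_real (- 2 * x / u)" by (simp add: s1_def complex_eq_iff)
    have sp: "s1 * cnj s1 = of_real (1 / u ^ 2)"
      using y(2) u by (simp add: s1_def complex_eq_iff field_simps power2_eq_square)
    have e1: "- 2 * x / u + \<epsilon> / u = - 1" using u by (simp add: x_def field_simps)
    have e2: "1 / u ^ 2 + (- 2 * x / u) * (\<epsilon> / u) = a - b * (- \<epsilon> / u ^ 3)"
    proof -
      have "a * u ^ 3 = - \<epsilon> * (u ^ 2 + b)" using eq \<epsilon> by auto
      then have a: "a = - \<epsilon> * (u ^ 2 + b) / u ^ 3" using u by (subst nonzero_eq_divide_eq) auto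
      have "a - b * (- \<epsilon> / u ^ 3) = - \<epsilon> / u"
        using u by (subst a) (simp add: field_simps power2_eq_square power3_eq_cube)
      moreover have "1 / u ^ 2 + (- 2 * x / u) * (\<epsilon> / u) = - \<epsilon> / u"
        using u \<epsilon> by (auto simp: x_def field_simps power2_eq_square)
      ultimately show ?thesis by simp
    qed
    show "char_roots a b (of_real (- \<epsilon> / u ^ 3)) s1 (cnj s1) (of_real (\<epsilon> / u))"
      unfolding char_roots_def
    proof (intro conjI)
      show "s1 + cnj s1 + of_real (\<epsilon> / u) = - 1"
        unfolding ss of_real_add[symmetric] e1 by simp
      have "s1 * cnj s1 + s1 * of_real (\<epsilon> / u) + cnj s1 * of_real (\<epsilon> / u)
        = s1 * cnj s1 + (s1 + cnj s1) * of_real (\<epsilon> / u)" by (simp only: distrib_right add.assoc)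
      also have "\<dots> = of_real (1 / u ^ 2 + (- 2 * x / u) * (\<epsilon> / u))"
        unfolding ss sp of_real_add of_real_mult ..
      finally show "s1 * cnj s1 + s1 * of_real (\<epsilon> / u) + cnj s1 * of_real (\<epsilon> / u)
          = of_real a - of_real b * of_real (- \<epsilon> / u ^ 3)"
        unfolding e2 by simp
      show "s1 * cnj s1 * of_real (\<epsilon> / u) = - of_real (- \<epsilon> / u ^ 3)"
        unfolding sp of_real_mult[symmetric] of_real_minus[symmetric] of_real_eq_iff
        by (simp add: power2_eq_square power3_eq_cube)
    qed
    have "complex_of_real (norm s1 ^ 2) = of_real (1 / u ^ 2)"
      by (simp only: sp complex_norm_square)
    then have "norm s1 ^ 2 = (1 / u) ^ 2" unfolding of_real_eq_iff by (simp add: power_divide)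
    then show "norm s1 = 1 / u" by (rule power2_eq_imp_eq) (use u in auto)
    show "1 / u > 0" "Im s1 \<noteq> 0"
      using u(1) y(1) by (simp_all add: s1_def)
    show "\<bar>\<epsilon> / u\<bar> = 1 / u"
      using u(1) \<epsilon> by auto
    have "u + b / u > 0" using u(1) b by (simp add: add_pos_nonneg)
    then show "Im (Complex A B) \<noteq> 0"
      using u(1) \<epsilon> y(1) by (auto simp: B_def)
    show "Re (Complex A B) < q"
    proof -
      have "q - A = u ^ 3 * (u + 3 * b / u) / (2 * (3 + \<epsilon> * u))"
        using k by (simp add: A_def q_def divide_simps) (simp add: algebra_simps)
      also have "\<dots> > 0"
      proof (rule divide_pos_pos)
        show "2 * (3 + \<epsilon> * u) > 0" by (rule mult_pos_pos[OF zero_less_numeral k(1)])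
        show "u ^ 3 * (u + 3 * b / u) > 0" using u(1) b by (simp add: add_pos_nonneg)
      qed
      finally show ?thesis by simp
    qed
    show "complex_of_real q * (of_real (\<epsilon> / u) * ((of_real (\<epsilon> / u) - s1) * (of_real (\<epsilon> / u) - cnj s1)))
       = - (1 - of_real b * of_real (\<epsilon> / u))"
    proof -
      have "(t - s1) * (t - cnj s1) = t ^ 2 - (s1 + cnj s1) * t + s1 * cnj s1" for t
        by (simp add: algebra_simps power2_eq_square)
      then have "(of_real (\<epsilon> / u) - s1) * (of_real (\<epsilon> / u) - cnj s1)
         = of_real (\<epsilon> / u) ^ 2 - (s1 + cnj s1) * of_real (\<epsilon> / u) + s1 * cnj s1" .
      also have "\<dots> = of_real ((\<epsilon> / u) ^ 2 - (- 2 * x / u) * (\<epsilon> / u) + 1 / u ^ 2)"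
        unfolding ss sp by simp
      also have "(\<epsilon> / u) ^ 2 - (- 2 * x / u) * (\<epsilon> / u) + 1 / u ^ 2 = (3 + \<epsilon> * u) / u ^ 2"
        using \<epsilon> u by (auto simp: x_def field_simps power2_eq_square)
      finally have "(of_real (\<epsilon> / u) - s1) * (of_real (\<epsilon> / u) - cnj s1) = of_real ((3 + \<epsilon> * u) / u ^ 2)" .
      moreover have "q * ((\<epsilon> / u) * ((3 + \<epsilon> * u) / u ^ 2)) = - (1 - b * (\<epsilon> / u))"
      proof -
        have q: "q * (3 + \<epsilon> * u) = - (u ^ 3 * (\<epsilon> - b / u))" using k by (simp add: q_def)
        have "q * ((\<epsilon> / u) * ((3 + \<epsilon> * u) / u ^ 2)) = q * (3 + \<epsilon> * u) * (\<epsilon> / u ^ 3)"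
          by (simp add: power2_eq_square power3_eq_cube mult_ac)
        also have "\<dots> = - (u ^ 3 * (\<epsilon> - b / u)) * (\<epsilon> / u ^ 3)"
          unfolding q ..
        also have "\<dots> = - (1 - b * (\<epsilon> / u))"
          using u \<epsilon> by (auto simp: field_simps)
        finally show ?thesis .
      qed
      ultimately show ?thesis
        by (metis of_real_1 of_real_diff of_real_minus of_real_mult)
    qed
    show "Complex A B * (s1 * ((s1 - cnj s1) * (s1 - of_real (\<epsilon> / u)))) = - (1 - of_real b * s1)"
    proof -
      \<comment> \<open>Real and imaginary part of the factor multiplying
        \<open>Complex A B\<close>; the claim then splits into \<open>re\<close> and
        \<open>im\<close>.\<close>
      define D1 D2 where "D1 = 2 * (y * y) * (u + 2 * \<epsilon>) / u ^ 3" and "D2 = y * \<epsilon> * (3 + \<epsilon> * u) / u ^ 2"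
      have D2: "2 * y * (x * (x + \<epsilon>) - y * y) / u ^ 3 = D2"
      proof -
        have "2 * (x * (x + \<epsilon>) - y * y) = \<epsilon> * u * (3 + \<epsilon> * u)"
          unfolding y2 using \<epsilon> by (auto simp: x_def field_simps)
        then have "2 * y * (x * (x + \<epsilon>) - y * y) = y * (\<epsilon> * u * (3 + \<epsilon> * u))"
          by (metis mult.assoc mult.left_commute)
        then have "2 * y * (x * (x + \<epsilon>) - y * y) / u ^ 3 = y * (\<epsilon> * u * (3 + \<epsilon> * u)) / u ^ 3"
          by (simp only:)
        also have "\<dots> = D2"
          using u(1) by (simp add: D2_def power2_eq_square power3_eq_cube mult_ac)
        finally show ?thesis .
      qed
      have "s1 * ((s1 - cnj s1) * (s1 - of_real (\<epsilon> / u)))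
         = Complex (2 * (y * y) * (2 * x + \<epsilon>) / u ^ 3) (2 * y * (x * (x + \<epsilon>) - y * y) / u ^ 3)"
        using u by (simp add: s1_def complex_eq_iff field_simps power3_eq_cube)
      also have "\<dots> = Complex D1 D2"
        unfolding D2 by (simp add: D1_def x_def)
      finally have d: "s1 * ((s1 - cnj s1) * (s1 - of_real (\<epsilon> / u))) = Complex D1 D2" .
      have c1: "- (u ^ 3 * P / (2 * d)) * (2 * (d * Q / 4) * W / u ^ 3) = - (P * Q * W / 4)"
        and c2: "- (u ^ 3 * P / (2 * d)) * (y * \<epsilon> * d / u ^ 2) = - (P * y * u * \<epsilon> / 2)"
        if "d \<noteq> 0" for P Q W d :: real
        using that u(1) by (simp_all add: field_simps power2_eq_square power3_eq_cube)
      have "A * D1 = - ((u + 2 * \<epsilon> + b / u) * (1 - \<epsilon> * u) * (u + 2 * \<epsilon>) / 4)"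
        unfolding A_def D1_def y2 by (rule c1) (use k in auto)
      moreover have "B * D2 = (u + b / u) * u * (3 + \<epsilon> * u) / 4"
        unfolding B_def D2_def using u y \<epsilon> by (auto simp: power2_eq_square power3_eq_cube)
      moreover have "- ((u + 2 * \<epsilon> + b / u) * (1 - \<epsilon> * u) * (u + 2 * \<epsilon>) / 4) - (u + b / u) * u * (3 + \<epsilon> * u) / 4
          = - (1 + b * x / u)"
        using u \<epsilon> by (auto simp: x_def field_simps)
      ultimately have re: "A * D1 - B * D2 = - (1 + b * x / u)" by (simp only:)
      have "A * D2 = - ((u + 2 * \<epsilon> + b / u) * y * u * \<epsilon> / 2)"
        unfolding A_def D2_def by (rule c2) (use k in auto)
      moreover have "B * D1 = \<epsilon> * (u + b / u) * y * (u + 2 * \<epsilon>) / 2"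
        unfolding B_def D1_def using u y by simp
      moreover have "- ((u + 2 * \<epsilon> + b / u) * y * u * \<epsilon> / 2) + \<epsilon> * (u + b / u) * y * (u + 2 * \<epsilon>) / 2 = b * y / u"
        using u \<epsilon> by (auto simp: field_simps)
      ultimately have im: "A * D2 + B * D1 = b * y / u" by (simp only:)
      show ?thesis
        unfolding d using re im by (simp add: complex_eq_iff s1_def)
    qed
  qed
qed

text \<open>With \<open>\<epsilon> = 1\<close> the crossing polynomial is b at 0 and
  \<open>1 + a + b\<close> at 1, so it has a zero in the admissible range between 0 and 1. For
  \<open>b = 0\<close> the end 0 is itself a zero, and \<open>- 1 / a\<close> is given
  directly.\<close>

lemma not_real_rooted_of_lower:
  fixes a b :: real
  assumes "b \<ge> 0" "1 + a + b < 0"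
  shows "\<exists>m. \<not> real_rooted (H a b m)"
proof -
  let ?f = "\<lambda>u. u ^ 2 + b + 1 * a * u ^ 3"
  have "\<exists>u\<ge>0. u \<le> 1 \<and> ?f u = 0" if "b > 0"
    using assms that by (intro IVT2') (auto intro!: continuous_intros)
  then have "\<exists>u>0. u < 1 \<and> ?f u = 0"
  proof (cases "b = 0")
    case True
    then show ?thesis using assms
      by (intro exI[of _ "- 1 / a"]) (auto simp: field_simps power2_eq_square power3_eq_cube)
  next
    case False
    then obtain u where u: "0 \<le> u" "u \<le> 1" "?f u = 0" 
      using \<open>b > 0 \<Longrightarrow> _\<close> assms by auto
    moreover have "u \<noteq> 0" "u \<noteq> 1" using u(3) False assms by auto
    ultimately show ?thesis by (intro exI[of _ u]) auto
  qed
  then obtain u where "u > 0" "u < 1" "?f u = 0" by blast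
  then show ?thesis using assms by (intro not_real_rooted_of_crossing[of 1 u b a]) auto
qed

text \<open>With \<open>\<epsilon> = - 1\<close> the admissible range of u is from 0 to 3, and the
  crossing polynomial is b at 0 and \<open>9 - 27 * a + b\<close> at 3.\<close>

lemma not_real_rooted_of_upper:
  fixes a b :: real
  assumes "b \<ge> 0" "9 - 27 * a + b < 0"
  shows "\<exists>m. \<not> real_rooted (H a b m)"
proof -
  let ?f = "\<lambda>u. u ^ 2 + b + - 1 * a * u ^ 3"
  have "\<exists>u>0. u < 3 \<and> ?f u = 0"
  proof (cases "b = 0")
    case True
    then show ?thesis using assms
      by (intro exI[of _ "1 / a"]) (auto simp: field_simps power2_eq_square power3_eq_cube)
  next
    case False
    have "\<exists>u\<ge>0. u \<le> 3 \<and> ?f u = 0"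
      using assms by (intro IVT2') (auto intro!: continuous_intros)
    then obtain u where u: "0 \<le> u" "u \<le> 3" "?f u = 0" by auto
    moreover have "u \<noteq> 0" "u \<noteq> 3" using u(3) False assms by auto
    ultimately show ?thesis by (intro exI[of _ u]) auto
  qed
  then obtain u where "u > 0" "u < 3" "?f u = 0" by blast
  then show ?thesis using assms by (intro not_real_rooted_of_crossing[of "- 1" u b a]) auto
qed

theorem theorem2:
  fixes a b :: real
  assumes "b \<ge> 0"
  shows "(\<forall>m. real_rooted (H a b m)) \<longleftrightarrow> (1 + a + b \<ge> 0 \<and> 9 - 27 * a + b \<ge> 0)"
proof
  assume real: "\<forall>m. real_rooted (H a b m)"
  show "1 + a + b \<ge> 0 \<and> 9 - 27 * a + b \<ge> 0"
    using real not_real_rooted_of_lower[OF assms, of a] not_real_rooted_of_upper[OF assms, of a]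
    by (meson not_le)
next
  assume "1 + a + b \<ge> 0 \<and> 9 - 27 * a + b \<ge> 0"
  then interpret admissible a b
    using assms by unfold_locales auto
  show "\<forall>m. real_rooted (H a b m)"
    using real_rooted_H by blast
qed

end
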